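(* Let $f:\mathbb{T}\to[0,1]$ be a Borel function with $0<\sigma:=\int_{\mathbb{T}} f\,d\mathfrak{m}<1$, and let $\mathfrak{X}$ be the determinantal point process on $\mathbb{Z}$ induced by the kernel $K_f(n,m)=\widehat{f}(n-m)$. Then almost surely $\mathfrak{X}_+:=\mathfrak{X}\cap\mathbb{N}$ is $L^2$-exact, and therefore is recurrent.
   Context: $\mathbb{T}=\mathbb{R}/\mathbb{Z}$ with normalized Lebesgue measure $\mathfrak{m}$; $\widehat{f}(n)=\int_{\mathbb{T}} f(t)e^{-2\pi i n t}\,d\mathfrak{m}(t)$; $\mathbb{N}$ is the set of non-negative integers. The (stationary) determinantal point process $\mathfrak{X}$ induced by $K_f$ is the random subset $\mathfrak{X}=\mathfrak{X}(\omega)$ of $\mathbb{Z}$, defined on a probability space $(\Omega,\mathcal{A},\mathbb{P})$, whose indicator random variables $\xi_n(\omega)=1$ if $n\in\mathfrak{X}(\omega)$ and $\xi_n(\omega)=0$ otherwise satisfy, for all distinct $n_1,\dots,n_k\in\mathbb{Z}$, $\mathbb{E}(\xi_{n_1}\cdots\xi_{n_k})=\det(\widehat{f}(n_i-n_j))_{1\le i,j\le k}$. Such a process exists and its law is uniquely determined by $f$. A measure-preserving system $(X,\mathcal{B},\nu,T)$ is a probability space with a measurable map $T$ preserving $\nu$. Let $\Lambda=\{u_0<u_1<u_2<\cdots\}$ be an infinite set of non-negative integers. $\Lambda$ is recurrent if for every measure-preserving system $(X,\mathcal{B},\nu,T)$ and every $A\in\mathcal{B}$ with $\nu(A)>0$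 there exists $n\in\Lambda$, $n\ge 1$, such that $\nu(A\cap T^{-n}A)>0$. $\Lambda$ is $L^2$-exact if for every measure-preserving system $(X,\mathcal{B},\nu,T)$ and every $g\in L^2(\nu)$ the averages $\frac1N\sum_{n=0}^{N-1} g(T^{u_n}x)$ converge in $L^2(\nu)$, as $N\to\infty$, to $\mathbb{E}(g\mid\mathcal{J}_T)$, the conditional expectation with respect to the $\sigma$-field $\mathcal{J}_T$ of $T$-invariant sets. "Almost surely" means that there is an event of probability one, independent of the dynamical system, on which the property holds. *)

theory Defs
  imports "HOL-Probability.Probability" "Jordan_Normal_Form.Determinant"
begin

text \<open>Functions on the circle are represented by 1-periodic functions on the real line, and
  integrals over the circle by integrals over the fundamental domain \<open>{0..<1}\<close>.\<close>

definition fourier_coeff :: "(real \<Rightarrow> real) \<Rightarrow> int \<Rightarrow> complex" where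
  "fourier_coeff f n =
     (LBINT t:{0..<1}. complex_of_real (f t) * exp (- 2 * of_real pi * \<i> * of_int n * of_real t))"

text \<open>The tuples of distinct points are injective maps on \<open>{..<k}\<close>. The qualified name is needed
  because \<open>det\<close> also denotes the determinant of type-indexed matrices.\<close>

definition determinantal_process ::
    "'w measure \<Rightarrow> (int \<Rightarrow> int \<Rightarrow> complex) \<Rightarrow> ('w \<Rightarrow> int set) \<Rightarrow> bool" where
  "determinantal_process P K X \<longleftrightarrow>
     prob_space P \<and>
     (\<forall>n. {\<omega> \<in> space P. n \<in> X \<omega>} \<in> sets P) \<and>
     (\<forall>k (p :: nat \<Rightarrow> int). inj_on p {..<k} \<longrightarrow>
        complex_of_real (\<integral>\<omega>. (\<Prod>i<k. indicat_real (X \<omega>) (p i)) \<partial>P) =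
          Determinant.det (mat k k (\<lambda>(i, j). K (p i) (p j))))"

definition measure_preserving_system :: "'a measure \<Rightarrow> ('a \<Rightarrow> 'a) \<Rightarrow> bool" where
  "measure_preserving_system M T \<longleftrightarrow>
     prob_space M \<and> T \<in> measurable M M \<and> distr M M T = M"

definition invariant_algebra :: "'a measure \<Rightarrow> ('a \<Rightarrow> 'a) \<Rightarrow> 'a measure" where
  "invariant_algebra M T = sigma (space M) {A \<in> sets M. T -` A \<inter> space M = A}"

definition complex_cond_exp ::
    "'a measure \<Rightarrow> 'a measure \<Rightarrow> ('a \<Rightarrow> complex) \<Rightarrow> 'a \<Rightarrow> complex" where
  "complex_cond_exp M F g x =
     Complex (real_cond_exp M F (\<lambda>y. Re (g y)) x) (real_cond_exp M F (\<lambda>y. Im (g y)) x)"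

text \<open>The following two notions quantify over all systems whose underlying set is the universe of
  a type \<open>'a\<close> or a subset of it; the type is passed as an argument. The set is required to be
  infinite, and \<open>enumerate \<Lambda>\<close> then lists its elements in increasing order.\<close>

definition L2_exact :: "'a itself \<Rightarrow> nat set \<Rightarrow> bool" where
  "L2_exact _ \<Lambda> \<longleftrightarrow> infinite \<Lambda> \<and>
     (\<forall>(M :: 'a measure) T (g :: 'a \<Rightarrow> complex).
        measure_preserving_system M T \<longrightarrow>
        g \<in> borel_measurable M \<longrightarrow> integrable M (\<lambda>x. (norm (g x))\<^sup>2) \<longrightarrow>
        ((\<lambda>N. \<integral>\<^sup>+x. ennreal ((norm ((\<Sum>n<N. g ((T ^^ enumerate \<Lambda> n) x)) / of_nat N
                 - complex_cond_exp M (invariant_algebra M T) g x))\<^sup>2) \<partial>M)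
           \<longlonglongrightarrow> 0))"

definition recurrent :: "'a itself \<Rightarrow> nat set \<Rightarrow> bool" where
  "recurrent _ \<Lambda> \<longleftrightarrow> infinite \<Lambda> \<and>
     (\<forall>(M :: 'a measure) T A.
        measure_preserving_system M T \<longrightarrow> A \<in> sets M \<longrightarrow> measure M A > 0 \<longrightarrow>
        (\<exists>n\<in>\<Lambda>. n \<ge> 1 \<and> measure M (A \<inter> (T ^^ n) -` A) > 0))"

definition nonneg_part :: "int set \<Rightarrow> nat set" where
  "nonneg_part S = {n. int n \<in> S}"

text \<open>A single event has to serve systems on every type, but a formula cannot quantify over types
  under an existential quantifier. So the event is described without mentioning the type of the
  system: it consists of the outcomes that are good for all systems (with arbitrary
  \<open>\<sigma>\<close>-algebra, measure and map) living on the space of complex sequences. That it is also good for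
  the systems on any other type is not part of the definition and has to be claimed
  separately.\<close>

definition good_event :: "'w measure \<Rightarrow> ('w \<Rightarrow> int set) \<Rightarrow> 'w set" where
  "good_event P X =
     {\<omega> \<in> space P. L2_exact TYPE(nat \<Rightarrow> complex) (nonneg_part (X \<omega>)) \<and>
                    recurrent TYPE(nat \<Rightarrow> complex) (nonneg_part (X \<omega>))}"

end

theory Submission
  imports Defs "HOL-Library.Discrete_Functions"
begin

text \<open>Let \<open>a\<^sub>n = 1\<^sub>X(n) - \<sigma>\<close> and \<open>c\<^sub>h = \<Sum>n<N-h. a\<^sub>n a\<^sub>n\<^sub>+\<^sub>h\<close>. Expanding the square, every measure-preserving
  map \<open>T\<close> satisfies \<open>\<parallel>\<Sum>n<N. a\<^sub>n g \<circ> T\<^sup>n\<parallel>\<^sup>2 \<le> 2 \<parallel>g\<parallel>\<^sup>2 \<Sum>h<N. \<bar>c\<^sub>h\<bar>\<close>, so it is enough that almost surely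
  \<open>\<Sum>h<N. \<bar>c\<^sub>h\<bar> = o(N\<^sup>2)\<close>, a condition that does not mention the system; the remaining part \<open>\<sigma> g \<circ> T\<^sup>n\<close> is
  handled by the mean ergodic theorem. The centred fourth moments of the process are sums over
  derangements of four points, hence are bounded by products of two squared Fourier coefficients
  over the three pairings; as these squares are summable, \<open>E (\<Sum>h<N. c\<^sub>h\<^sup>2) = O(N\<^sup>2)\<close>. By Cauchy-Schwarz and
  Borel-Cantelli the condition holds along \<open>N = m\<^sup>2\<close>, and then along all \<open>N\<close>.\<close>

section \<open>Fourth moments of determinantal processes\<close>

text \<open>The exceptional null set has to be fixed before the system is chosen, and there are too
  many systems to intersect one event for each of them. All randomness is therefore pushed into the
  scalars \<open>c\<^sub>h\<close>, which a purely deterministic inequality couples to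
  \<open>(T, g)\<close>. The price is the loss of cancellation between different lags: with
  \<open>Q = \<Sum>h<N. \<bar>c\<^sub>h\<bar>\<close> one gets only
  \<open>E (Q\<^sup>2) = O(N\<^sup>3)\<close>, so
  \<open>E ((Q / N\<^sup>2)\<^sup>2) = O(1/N)\<close>. This is not summable over all
  \<open>N\<close>, but it is along squares, and between two consecutive squares \<open>Q\<close>
  changes only by \<open>o(N\<^sup>2)\<close>.

  Of the kernel very little enters: it is Hermitian, depends on differences only, and has the
  constant diagonal \<sigma>. Even the summability of the squared Fourier coefficients is read off
  from the process.

  The remaining steps are deterministic. Recurrence follows from exactness for the same set, and
  exactness on the space of complex sequences passes to every type, because an orbit of
  \<open>g\<close> is a sequence and \<open>T\<close> acts on it as the shift. No further null set
  is discarded.\<close>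

text \<open>Laplace expansion along row 0. The minors are written again as \<open>mat n n\<close> of
  an entry function, with column \<open>j\<close> skipped, so that the rule can be iterated down to
  size 0.\<close>

lemma det_mat_Suc:
  "Determinant.det (mat (Suc n) (Suc n) (\<lambda>(i, j). A i j)) =
     (\<Sum>j<Suc n. (- 1) ^ j * A 0 j *
        Determinant.det (mat n n (\<lambda>(i, l). A (Suc i) (if l < j then l else Suc l))))"
  for A :: "nat \<Rightarrow> nat \<Rightarrow> 'b :: comm_ring_1"
proof -
  have minor: "mat_delete (mat (Suc n) (Suc n) (\<lambda>(i, j). A i j)) 0 l =
    mat n n (\<lambda>(i, j). A (Suc i) (if j < l then j else Suc j))" if "l < Suc n" for l
    using that by (auto simp: mat_delete_def)
  have "Determinant.det (mat (Suc n) (Suc n) (\<lambda>(i, j). A i j)) =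
    (\<Sum>j<Suc n. mat (Suc n) (Suc n) (\<lambda>(i, j). A i j) $$ (0, j) *
       cofactor (mat (Suc n) (Suc n) (\<lambda>(i, j). A i j)) 0 j)"
    by (rule laplace_expansion_row) auto
  also have "\<dots> = (\<Sum>j<Suc n. (- 1) ^ j * A 0 j *
        Determinant.det (mat n n (\<lambda>(i, l). A (Suc i) (if l < j then l else Suc l))))"
    by (rule sum.cong) (simp_all add: cofactor_def minor mult_ac)
  finally show ?thesis .
qed

lemma det_mat_1: "Determinant.det (mat (Suc 0) (Suc 0) (\<lambda>(i, j). A i j)) = (A 0 0 :: 'b :: comm_ring_1)"
  by (simp add: det_mat_Suc det_dim_zero)

lemma det_mat_2:
  "Determinant.det (mat (Suc (Suc 0)) (Suc (Suc 0)) (\<lambda>(i, j). A i j)) =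
   A 0 0 * A 1 1 - A 0 1 * (A 1 0 :: 'b :: comm_ring_1)"
  by (subst det_mat_Suc) (simp add: det_mat_1)

lemma det_mat_3:
  "Determinant.det (mat (Suc (Suc (Suc 0))) (Suc (Suc (Suc 0))) (\<lambda>(i, j). A i j)) =
     A 0 0 * (A 1 1 * A 2 2 - A 1 2 * A 2 1) - A 0 1 * (A 1 0 * A 2 2 - A 1 2 * A 2 0) +
     A 0 2 * (A 1 0 * A 2 1 - A 1 1 * (A 2 0 :: 'b :: comm_ring_1))"
  by (subst det_mat_Suc) (simp add: det_mat_2 numeral_2_eq_2)

lemma det_mat_4:
  "Determinant.det (mat (Suc (Suc (Suc (Suc 0)))) (Suc (Suc (Suc (Suc 0)))) (\<lambda>(i, j). A i j)) =
     A 0 0 * (A 1 1 * (A 2 2 * A 3 3 - A 2 3 * A 3 2) - A 1 2 * (A 2 1 * A 3 3 - A 2 3 * A 3 1)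
              + A 1 3 * (A 2 1 * A 3 2 - A 2 2 * A 3 1))
   - A 0 1 * (A 1 0 * (A 2 2 * A 3 3 - A 2 3 * A 3 2) - A 1 2 * (A 2 0 * A 3 3 - A 2 3 * A 3 0)
              + A 1 3 * (A 2 0 * A 3 2 - A 2 2 * A 3 0))
   + A 0 2 * (A 1 0 * (A 2 1 * A 3 3 - A 2 3 * A 3 1) - A 1 1 * (A 2 0 * A 3 3 - A 2 3 * A 3 0)
              + A 1 3 * (A 2 0 * A 3 1 - A 2 1 * A 3 0))
   - A 0 3 * (A 1 0 * (A 2 1 * A 3 2 - A 2 2 * A 3 1) - A 1 1 * (A 2 0 * A 3 2 - A 2 2 * A 3 0)
              + A 1 2 * (A 2 0 * A 3 1 - A 2 1 * (A 3 0 :: 'b :: comm_ring_1)))"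
  by (subst det_mat_Suc) (simp add: det_mat_3 numeral_2_eq_2 numeral_3_eq_3)
lemmas det_mat_explicit = det_mat_1 det_mat_2 det_mat_3 det_mat_4

text \<open>Centring a determinantal process removes the diagonal of its kernel, so that only the
  permutations without fixed points remain.\<close>

lemma centered_det_4_eq:
  fixes s ab ac ad ba bc bd ca cb cd da db dc :: "'a :: comm_ring_1"
  shows "s * (s * (s * s - cd * dc) - bc * (cb * s - cd * db) + bd * (cb * dc - s * db))
   - ab * (ba * (s * s - cd * dc) - bc * (ca * s - cd * da) + bd * (ca * dc - s * da))
   + ac * (ba * (cb * s - cd * db) - s * (ca * s - cd * da) + bd * (ca * db - cb * da))
   - ad * (ba * (cb * dc - s * db) - s * (ca * dc - s * da) + bc * (ca * db - cb * da))
   - s * ((s * (s * s - bc * cb) - ab * (ba * s - bc * ca) + ac * (ba * cb - s * ca))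
     + (s * (s * s - bd * db) - ab * (ba * s - bd * da) + ad * (ba * db - s * da))
     + (s * (s * s - cd * dc) - ac * (ca * s - cd * da) + ad * (ca * dc - s * da))
     + (s * (s * s - cd * dc) - bc * (cb * s - cd * db) + bd * (cb * dc - s * db)))
   + s^2 * ((s * s - ab * ba) + (s * s - ac * ca) + (s * s - ad * da) + (s * s - bc * cb)
     + (s * s - bd * db) + (s * s - cd * dc))
   - s^3 * (s + s + s + s) + s^4 =
    (ab * ba) * (cd * dc) + (ac * ca) * (bd * db) + (ad * da) * (bc * cb)
    - ab * bc * cd * da - ab * bd * dc * ca - ac * cb * bd * da
    - ac * cd * db * ba - ad * db * bc * ca - ad * dc * cb * ba"
  by (simp add: ring_distribs power_numeral_reduce mult_ac)

text \<open>The moments are indexed by distinct lists, so that explicit tuples such as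
  \<open>[a, b, c, d]\<close> can be inserted directly. Stationarity enters only through the
  constant diagonal; the dependence on differences is added later.\<close>

locale determinantal_indicators = prob_space P for P :: "'w measure" +
  fixes K :: "int \<Rightarrow> int \<Rightarrow> complex" and x :: "int \<Rightarrow> 'w \<Rightarrow> real" and s :: real
  assumes x_measurable [measurable]: "x n \<in> borel_measurable P"
    and x_nonneg: "0 \<le> x n \<omega>" and x_le_1: "x n \<omega> \<le> 1"
    and moments: "distinct ps \<Longrightarrow> complex_of_real (\<integral>\<omega>. (\<Prod>p\<leftarrow>ps. x p \<omega>) \<partial>P) =
      Determinant.det (mat (length ps) (length ps) (\<lambda>(i, j). K (ps ! i) (ps ! j)))"
    and diagonal: "K n n = s"
    and hermitian: "K m n = cnj (K n m)"
begin

lemma expectation_1: "complex_of_real (\<integral>\<omega>. x a \<omega> \<partial>P) = s"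
  using moments[of "[a]"] by (simp add: det_mat_explicit diagonal mult.assoc)

lemma expectation_2: "a \<noteq> b \<Longrightarrow> complex_of_real (\<integral>\<omega>. x a \<omega> * x b \<omega> \<partial>P) =
   s * s - K a b * K b a"
  using moments[of "[a, b]"] by (simp add: det_mat_explicit diagonal mult.assoc)

lemma expectation_3: "distinct [a,b,c] \<Longrightarrow> complex_of_real (\<integral>\<omega>. x a \<omega> * x b \<omega> * x c \<omega> \<partial>P) =
   s * (s * s - K b c * K c b) - K a b * (K b a * s - K b c * K c a)
   + K a c * (K b a * K c b - s * K c a)"
  using moments[of "[a, b, c]"]
  by (simp add: det_mat_explicit diagonal mult.assoc)

lemma expectation_4: "distinct [a,b,c,d] \<Longrightarrow> complex_of_real (\<integral>\<omega>. x a \<omega> * x b \<omega> * x c \<omega> * x d \<omega> \<partial>P) =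
   s * (s * (s * s - K c d * K d c) - K b c * (K c b * s - K c d * K d b)
        + K b d * (K c b * K d c - s * K d b))
   - K a b * (K b a * (s * s - K c d * K d c) - K b c * (K c a * s - K c d * K d a)
        + K b d * (K c a * K d c - s * K d a))
   + K a c * (K b a * (K c b * s - K c d * K d b) - s * (K c a * s - K c d * K d a)
        + K b d * (K c a * K d b - K c b * K d a))
   - K a d * (K b a * (K c b * K d c - s * K d b) - s * (K c a * K d c - s * K d a)
        + K b c * (K c a * K d b - K c b * K d a))"
  using moments[of "[a, b, c, d]"]
  by (simp add: det_mat_explicit diagonal mult.assoc)

lemma integrable_prod_indicators:
  "integrable P (x a)" "integrable P (\<lambda>\<omega>. x a \<omega> * x b \<omega>)"
  "integrable P (\<lambda>\<omega>. x a \<omega> * x b \<omega> * x c \<omega>)"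
  "integrable P (\<lambda>\<omega>. x a \<omega> * x b \<omega> * x c \<omega> * x d \<omega>)"
  by (rule integrable_const_bound[where B = 1]; simp add: x_nonneg x_le_1 mult_le_one)+

text \<open>The nine derangements of four points are three products of two disjoint transpositions,
  of sign +1, and six 4-cycles, of sign -1.\<close>

lemma expectation_centered_4:
  assumes d: "distinct [a,b,c,d]"
  shows "complex_of_real (\<integral>\<omega>. (x a \<omega> - s) * (x b \<omega> - s) * (x c \<omega> - s) * (x d \<omega> - s) \<partial>P) =
    (K a b * K b a) * (K c d * K d c) + (K a c * K c a) * (K b d * K d b) + (K a d * K d a) * (K b c * K c b)
    - K a b * K b c * K c d * K d a - K a b * K b d * K d c * K c a - K a c * K c b * K b d * K d a
    - K a c * K c d * K d b * K b a - K a d * K d b * K b c * K c a - K a d * K d c * K c b * K b a"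
    (is "?lhs = ?rhs")
proof -
  note [simp] = integrable_prod_indicators
  have "(x a \<omega> - s) * (x b \<omega> - s) * (x c \<omega> - s) * (x d \<omega> - s) =
     x a \<omega> * x b \<omega> * x c \<omega> * x d \<omega>
     - s * (x a \<omega> * x b \<omega> * x c \<omega> + x a \<omega> * x b \<omega> * x d \<omega> + x a \<omega> * x c \<omega> * x d \<omega> + x b \<omega> * x c \<omega> * x d \<omega>)
     + s^2 * (x a \<omega> * x b \<omega> + x a \<omega> * x c \<omega> + x a \<omega> * x d \<omega> + x b \<omega> * x c \<omega> + x b \<omega> * x d \<omega> + x c \<omega> * x d \<omega>)
     - s^3 * (x a \<omega> + x b \<omega> + x c \<omega> + x d \<omega>) + s^4" for \<omega>
    by (simp add: algebra_simps power2_eq_square power3_eq_cube power4_eq_xxxx)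
  then have expand: "?lhs =
     complex_of_real (\<integral>\<omega>. x a \<omega> * x b \<omega> * x c \<omega> * x d \<omega> \<partial>P)
     - complex_of_real s * (complex_of_real (\<integral>\<omega>. x a \<omega> * x b \<omega> * x c \<omega> \<partial>P) + complex_of_real (\<integral>\<omega>. x a \<omega> * x b \<omega> * x d \<omega> \<partial>P)
       + complex_of_real (\<integral>\<omega>. x a \<omega> * x c \<omega> * x d \<omega> \<partial>P) + complex_of_real (\<integral>\<omega>. x b \<omega> * x c \<omega> * x d \<omega> \<partial>P))
     + complex_of_real s ^ 2 * (complex_of_real (\<integral>\<omega>. x a \<omega> * x b \<omega> \<partial>P) + complex_of_real (\<integral>\<omega>. x a \<omega> * x c \<omega> \<partial>P)
       + complex_of_real (\<integral>\<omega>. x a \<omega> * x d \<omega> \<partial>P) + complex_of_real (\<integral>\<omega>. x b \<omega> * x c \<omega> \<partial>P)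
       + complex_of_real (\<integral>\<omega>. x b \<omega> * x d \<omega> \<partial>P) + complex_of_real (\<integral>\<omega>. x c \<omega> * x d \<omega> \<partial>P))
     - complex_of_real s ^ 3 * (complex_of_real (\<integral>\<omega>. x a \<omega> \<partial>P) + complex_of_real (\<integral>\<omega>. x b \<omega> \<partial>P)
       + complex_of_real (\<integral>\<omega>. x c \<omega> \<partial>P) + complex_of_real (\<integral>\<omega>. x d \<omega> \<partial>P)) + complex_of_real s ^ 4"
    by (simp add: prob_space)
  have ne: "a \<noteq> b" "a \<noteq> c" "a \<noteq> d" "b \<noteq> c" "b \<noteq> d" "c \<noteq> d"
    using d by auto
  have "distinct [a,b,c]" "distinct [a,b,d]" "distinct [a,c,d]" "distinct [b,c,d]"
    using d by auto
  note e = this[THEN expectation_3] ne[THEN expectation_2] expectation_1 expectation_4[OF d]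
  show ?thesis
    by (rule expand[unfolded e of_real_mult centered_det_4_eq])
qed

lemma expectation_centered_2:
  assumes d: "a \<noteq> b"
  shows "complex_of_real (\<integral>\<omega>. (x a \<omega> - s) * (x b \<omega> - s) \<partial>P) = - K a b * K b a"
proof -
  note [simp] = integrable_prod_indicators
  have "(x a \<omega> - s) * (x b \<omega> - s) = x a \<omega> * x b \<omega> - s * (x a \<omega> + x b \<omega>) + s^2" for \<omega>
    by (simp add: algebra_simps power2_eq_square)
  then have "complex_of_real (\<integral>\<omega>. (x a \<omega> - s) * (x b \<omega> - s) \<partial>P) =
     complex_of_real (\<integral>\<omega>. x a \<omega> * x b \<omega> \<partial>P)
     - s * (complex_of_real (\<integral>\<omega>. x a \<omega> \<partial>P) + complex_of_real (\<integral>\<omega>. x b \<omega> \<partial>P)) + s^2"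
    by (simp add: prob_space)
  then show ?thesis
    unfolding expectation_1 expectation_2[OF d] by (simp add: algebra_simps power2_eq_square)
qed

text \<open>With \<open>u\<close>, \<open>v\<close>, \<open>w\<close> the moduli of the three
  pairings, a 4-cycle and its inverse both have modulus \<open>u * v\<close>, \<open>u * w\<close>
  or \<open>v * w\<close>. The total is at most the sum of the squares plus
  \<open>2 * (u * v + u * w + v * w)\<close>, hence at most three times the sum of the
  squares.\<close>

lemma norm_expectation_centered_4_le:
  assumes d: "distinct [a,b,c,d]"
  shows "\<bar>\<integral>\<omega>. (x a \<omega> - s) * (x b \<omega> - s) * (x c \<omega> - s) * (x d \<omega> - s) \<partial>P\<bar> \<le>
    3 * ((cmod (K a b))^2 * (cmod (K c d))^2 + (cmod (K a c))^2 * (cmod (K b d))^2 + (cmod (K a d))^2 * (cmod (K b c))^2)"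
proof -
  have sym: "cmod (K j i) = cmod (K i j)" for i j
    using hermitian[of j i] by (metis complex_mod_cnj)
  have "\<bar>\<integral>\<omega>. (x a \<omega> - s) * (x b \<omega> - s) * (x c \<omega> - s) * (x d \<omega> - s) \<partial>P\<bar> =
    cmod (complex_of_real (\<integral>\<omega>. (x a \<omega> - s) * (x b \<omega> - s) * (x c \<omega> - s) * (x d \<omega> - s) \<partial>P))"
    by simp
  also note expectation_centered_4[OF d]
  also have "cmod (v1 + v2 + v3 - v4 - v5 - v6 - v7 - v8 - v9) \<le> cmod v1 + cmod v2 + cmod v3
    + cmod v4 + cmod v5 + cmod v6 + cmod v7 + cmod v8 + cmod v9" for v1 v2 v3 v4 v5 v6 v7 v8 v9
    by (intro norm_triangle_le norm_triangle_le_diff add_mono order_refl)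
  finally have le: "\<bar>\<integral>\<omega>. (x a \<omega> - s) * (x b \<omega> - s) * (x c \<omega> - s) * (x d \<omega> - s) \<partial>P\<bar> \<le>
     (let t = (\<lambda>i j. cmod (K i j)) in (t a b)^2 * (t c d)^2 + (t a c)^2 * (t b d)^2 + (t a d)^2 * (t b c)^2
     + 2 * ((t a b * t c d) * (t a d * t b c)) + 2 * ((t a b * t c d) * (t a c * t b d))
     + 2 * ((t a c * t b d) * (t a d * t b c)))"
    by (simp add: norm_mult Let_def sym[of b a] sym[of c a] sym[of d a] sym[of c b] sym[of d b] sym[of d c]
        power2_eq_square mult_ac)
  \<comment> \<open>AM-GM turns each of the six 4-cycles into two pairings.\<close>
  have am_gm: "2 * (u * v) \<le> u\<^sup>2 + v\<^sup>2" for u v :: real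
    using sum_squares_bound[of u v] by simp
  show ?thesis
    using le am_gm[of "cmod (K a b) * cmod (K c d)" "cmod (K a d) * cmod (K b c)"]
     am_gm[of "cmod (K a b) * cmod (K c d)" "cmod (K a c) * cmod (K b d)"]
     am_gm[of "cmod (K a c) * cmod (K b d)" "cmod (K a d) * cmod (K b c)"]
    by (simp add: Let_def power_mult_distrib)
qed

end

section \<open>Ergodic theorems\<close>

text \<open>Dominated convergence with a dominating function that moves with \<open>n\<close>. In
  the application \<open>H n\<close> is essentially a Birkhoff average of the squared modulus of
  \<open>g\<close>: it has no common integrable majorant in general, but its integral is constant
  and equal to that of its limit.\<close>

lemma integral_tendsto_0_dominated_convergent:
  fixes u H :: "nat \<Rightarrow> 'a \<Rightarrow> real"
  assumes u: "\<And>n. u n \<in> borel_measurable M" "\<And>n x. 0 \<le> u n x" "\<And>n x. x \<in> space M \<Longrightarrow> u n x \<le> H n x"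
    and H: "\<And>n. integrable M (H n)" "integrable M h" "\<And>n. (\<integral>x. H n x \<partial>M) = (\<integral>x. h x \<partial>M)"
    and lim: "AE x in M. (\<lambda>n. u n x) \<longlonglongrightarrow> 0" "AE x in M. (\<lambda>n. H n x) \<longlonglongrightarrow> h x"
  shows "(\<lambda>n. \<integral>x. u n x \<partial>M) \<longlonglongrightarrow> 0"
proof -
  note [measurable] = u(1) borel_measurable_integrable[OF H(1)] borel_measurable_integrable[OF H(2)]
  have H_nonneg: "0 \<le> H n x" if "x \<in> space M" for n x
    using u(2)[of n x] u(3)[OF that, of n] by linarith
  have "AE x in M. 0 \<le> h x"
    using lim(2) AE_space
  proof eventually_elim
    case (elim x)
    then show ?case by (intro LIMSEQ_le_const[OF elim(1)]) (auto intro: H_nonneg)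
  qed
  have u_int: "integrable M (u n)" for n
  proof (rule Bochner_Integration.integrable_bound[OF H(1)[of n]])
    show "AE x in M. norm (u n x) \<le> norm (H n x)"
    proof (rule AE_I2)
      fix x assume "x \<in> space M"
      then show "norm (u n x) \<le> norm (H n x)"
        using u(2)[of n x] u(3)[of x n] by simp
    qed
  qed (rule u(1))
  have 1: "(\<lambda>n. \<integral>x. min (u n x) (h x) \<partial>M) \<longlonglongrightarrow> (\<integral>x. 0 \<partial>M)"
  proof (rule integral_dominated_convergence[where w = h])
    show "AE x in M. (\<lambda>n. min (u n x) (h x)) \<longlonglongrightarrow> 0"
      using lim(1) \<open>AE x in M. 0 \<le> h x\<close>
    proof eventually_elim
      case (elim x)
      then have "(\<lambda>n. min (u n x) (h x)) \<longlonglongrightarrow> min 0 (h x)" by (intro tendsto_intros)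
      then show ?case using elim by simp
    qed
    show "AE x in M. norm (min (u n x) (h x)) \<le> h x" for n
      using \<open>AE x in M. 0 \<le> h x\<close> by eventually_elim (use u(2) in auto)
  qed (use H in auto)
  have 2: "(\<lambda>n. \<integral>x. max (h x - H n x) 0 \<partial>M) \<longlonglongrightarrow> (\<integral>x. 0 \<partial>M)"
  proof (rule integral_dominated_convergence[where w = h])
    show "AE x in M. (\<lambda>n. max (h x - H n x) 0) \<longlonglongrightarrow> 0"
      using lim(2)
    proof eventually_elim
      case (elim x)
      then have "(\<lambda>n. max (h x - H n x) 0) \<longlonglongrightarrow> max (h x - h x) 0" by (intro tendsto_intros)
      then show ?case by simp
    qed
    show "AE x in M. norm (max (h x - H n x) 0) \<le> h x" for n
      using \<open>AE x in M. 0 \<le> h x\<close> AE_space by eventually_elim (use H_nonneg in auto)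
  qed (use H in auto)
  have i1: "integrable M (\<lambda>x. min (u n x) (h x))" for n
    by (intro integrable_min u_int H)
  have i2: "integrable M (\<lambda>x. max (h x - H n x) 0)" for n
    by (intro integrable_max Bochner_Integration.integrable_diff H integrable_zero)
  \<comment> \<open>The signed excess \<open>H n - h\<close> integrates to 0, so its positive part
    has the same integral as its negative part \<open>max (h - H n) 0\<close>, and the latter is
    dominated by \<open>h\<close>.\<close>
  have le: "(\<integral>x. u n x \<partial>M) \<le> (\<integral>x. min (u n x) (h x) \<partial>M) + (\<integral>x. max (h x - H n x) 0 \<partial>M)" for n
  proof -
    have "(\<integral>x. u n x \<partial>M) \<le> (\<integral>x. min (u n x) (h x) + max (h x - H n x) 0 + (H n x - h x) \<partial>M)"
    proof (intro integral_mono u_int Bochner_Integration.integrable_add Bochner_Integration.integrable_diff i1 i2 H)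
      show "u n x \<le> min (u n x) (h x) + max (h x - H n x) 0 + (H n x - h x)" if "x \<in> space M" for x
        using u(3)[OF that, of n] by linarith
    qed
    also have "\<dots> = (\<integral>x. min (u n x) (h x) \<partial>M) + (\<integral>x. max (h x - H n x) 0 \<partial>M)"
      using i1 i2 H by (simp add: Bochner_Integration.integral_add Bochner_Integration.integral_diff)
    finally show ?thesis .
  qed
  show ?thesis
  proof (rule tendsto_sandwich[OF _ _ tendsto_const])
    show "(\<lambda>n. (\<integral>x. min (u n x) (h x) \<partial>M) + (\<integral>x. max (h x - H n x) 0 \<partial>M)) \<longlonglongrightarrow> 0"
      using tendsto_add[OF 1 2] by simp
  qed (use le u(2) in \<open>auto intro!: always_eventually Bochner_Integration.integral_nonneg\<close>)
qed

section \<open>Measure-preserving maps and their strictly invariant sets\<close>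

locale mps = prob_space M for M :: "'a measure" +
  fixes T :: "'a \<Rightarrow> 'a"
  assumes T_measurable [measurable]: "T \<in> measurable M M"
    and T_preserving: "distr M M T = M"
begin

abbreviation J :: "'a measure" where "J \<equiv> invariant_algebra M T"

lemma funpow_measurable [measurable]: "T ^^ n \<in> measurable M M"
proof (induction n)
  case (Suc n)
  show ?case unfolding funpow.simps by (rule measurable_comp[OF Suc T_measurable])
qed (simp add: id_def)

lemma funpow_preserving: "distr M M (T ^^ n) = M"
proof (induction n)
  case (Suc n)
  have "distr M M (T \<circ> (T ^^ n)) = distr (distr M M (T ^^ n)) M T"
    by (simp add: distr_distr)
  then show ?case using Suc T_preserving by (simp add: comp_def)
qed (simp add: distr_id2)

lemma funpow_space: "x \<in> space M \<Longrightarrow> (T ^^ n) x \<in> space M"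
  using measurable_space[OF funpow_measurable] .

lemma T_space: "x \<in> space M \<Longrightarrow> T x \<in> space M"
  using measurable_space[OF T_measurable] .

lemma integral_funpow:
  fixes f :: "'a \<Rightarrow> 'b :: {banach, second_countable_topology}"
  assumes "f \<in> borel_measurable M"
  shows "(\<integral>x. f ((T ^^ n) x) \<partial>M) = (\<integral>x. f x \<partial>M)"
  using integral_distr[OF funpow_measurable[of n] assms] by (simp add: funpow_preserving)

lemma integrable_funpow:
  fixes f :: "'a \<Rightarrow> 'b :: {banach, second_countable_topology}"
  assumes "integrable M f"
  shows "integrable M (\<lambda>x. f ((T ^^ n) x))"
  using integrable_distr[OF funpow_measurable[of n], of f] assms by (simp add: funpow_preserving)

lemma space_J: "space J = space M"
  by (simp add: invariant_algebra_def space_measure_of_conv)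

lemma sets_J: "sets J = {A \<in> sets M. T -` A \<inter> space M = A}"
proof -
  have "sigma_algebra (space M) {A \<in> sets M. T -` A \<inter> space M = A}"
    unfolding sigma_algebra_iff2
  proof (intro conjI ballI allI impI)
    show "{A \<in> sets M. T -` A \<inter> space M = A} \<subseteq> Pow (space M)"
      using sets.sets_into_space by auto
    show "space M - A \<in> {A \<in> sets M. T -` A \<inter> space M = A}"
      if "A \<in> {A \<in> sets M. T -` A \<inter> space M = A}" for A
    proof -
      have "T -` (space M - A) \<inter> space M = space M - (T -` A \<inter> space M)"
        using T_space by blast
      then show ?thesis using that by auto
    qed
    show "(\<Union>i. A i) \<in> {A \<in> sets M. T -` A \<inter> space M = A}"
      if "range A \<subseteq> {A \<in> sets M. T -` A \<inter> space M = A}" for A :: "nat \<Rightarrow> 'a set"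
    proof -
      have "A i \<in> sets M" "T -` A i \<inter> space M = A i" for i
        using that by auto
      moreover have "T -` (\<Union>i. A i) \<inter> space M = (\<Union>i. T -` A i \<inter> space M)"
        by blast
      ultimately show ?thesis by auto
    qed
  qed simp
  then show ?thesis
    unfolding invariant_algebra_def by (rule sigma_algebra.sets_measure_of_eq)
qed

lemma subalgebra_J: "subalgebra M J"
  by (auto simp: subalgebra_def space_J sets_J)

lemma finite_measure_subalgebra_J: "finite_measure_subalgebra M J"
  by (simp add: finite_measure_subalgebra_def finite_measure_subalgebra_axioms_def
      finite_measure_axioms subalgebra_J)

lemmas sigma_finite_subalgebra_J =
  finite_measure_subalgebra_is_sigma_finite[OF finite_measure_subalgebra_J]

text \<open>In a T1 space the singleton \<open>{f x}\<close> is Borel, so the level set of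
  \<open>f\<close> through \<open>x\<close> is strictly invariant and contains \<open>T x\<close>.
  Invariance thus holds at every point and not merely almost everywhere, which spares null sets in
  all orbit arguments.\<close>

lemma measurable_J_iff:
  fixes f :: "'a \<Rightarrow> 'b :: t1_space"
  shows "f \<in> borel_measurable J \<longleftrightarrow> f \<in> borel_measurable M \<and> (\<forall>x\<in>space M. f (T x) = f x)"
proof safe
  assume f: "f \<in> borel_measurable J"
  then show "f \<in> borel_measurable M" by (rule measurable_from_subalg[OF subalgebra_J])
  fix x assume x: "x \<in> space M"
  have "f -` {f x} \<inter> space M \<in> sets J"
    using measurable_sets[OF f, of "{f x}"] by (simp add: space_J)
  then have "T -` (f -` {f x} \<inter> space M) \<inter> space M = f -` {f x} \<inter> space M"
    by (simp add: sets_J)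
  then have "x \<in> T -` (f -` {f x} \<inter> space M)" using x by blast
  then show "f (T x) = f x" by simp
next
  assume f: "f \<in> borel_measurable M" "\<forall>x\<in>space M. f (T x) = f x"
  show "f \<in> borel_measurable J"
  proof (rule measurableI)
    fix A :: "'b set" assume "A \<in> sets borel"
    then have "f -` A \<inter> space M \<in> sets M" using f(1) by auto
    moreover have "T x \<in> f -` A \<inter> space M \<longleftrightarrow> x \<in> f -` A" if "x \<in> space M" for x
      using f(2) that T_space[OF that] by simp
    then have "T -` (f -` A \<inter> space M) \<inter> space M = f -` A \<inter> space M"
      by blast
    ultimately show "f -` A \<inter> space J \<in> sets J"
      by (simp add: sets_J space_J)
  qed auto
qed

lemma invariant_set_funpow:
  assumes "A \<in> sets J" "x \<in> space M"
  shows "(T ^^ n) x \<in> A \<longleftrightarrow> x \<in> A"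
proof (induction n)
  case (Suc n)
  have "T -` A \<inter> space M = A" using assms by (simp add: sets_J)
  then have "T ((T ^^ n) x) \<in> A \<longleftrightarrow> (T ^^ n) x \<in> A"
    using funpow_space[OF assms(2), of n] by blast
  then show ?case using Suc by simp
qed simp

lemma invariant_function_funpow:
  assumes "f \<in> borel_measurable J" "x \<in> space M"
  shows "f ((T ^^ n) x) = (f x :: 'b :: t1_space)"
proof (induction n)
  case (Suc n)
  have "f (T ((T ^^ n) x)) = f ((T ^^ n) x)"
    using assms(1) funpow_space[OF assms(2)] unfolding measurable_J_iff by blast
  then show ?case using Suc by simp
qed simp

end

text \<open>The maximum of the Birkhoff sums of lengths 1 to \<open>n + 1\<close>. Peeling off the
  first summand, rather than taking \<open>Max\<close> over a set, makes the recursion behind the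
  maximal ergodic theorem hold by definition.\<close>

primrec max_sum :: "('a \<Rightarrow> 'a) \<Rightarrow> ('a \<Rightarrow> real) \<Rightarrow> nat \<Rightarrow> 'a \<Rightarrow> real" where
  "max_sum T f 0 x = f x"
| "max_sum T f (Suc n) x = f x + max 0 (max_sum T f n (T x))"

lemma sum_le_max_sum:
  "m \<le> n \<Longrightarrow> (\<Sum>k<Suc m. f ((T ^^ k) x)) \<le> max_sum T f n x"
proof (induction n arbitrary: m x)
  case (Suc n)
  show ?case
  proof (cases m)
    case (Suc l)
    then have "(\<Sum>k<Suc l. f ((T ^^ k) (T x))) \<le> max_sum T f n (T x)"
      using Suc.prems by (intro Suc.IH) simp
    moreover have "(\<Sum>k<Suc m. f ((T ^^ k) x)) = f x + (\<Sum>k<Suc l. f ((T ^^ k) (T x)))"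
      unfolding Suc by (subst sum.lessThan_Suc_shift) (simp add: funpow_swap1)
    ultimately show ?thesis by simp
  qed simp
qed simp

lemma max_sum_le_Suc: "max_sum T f n x \<le> max_sum T f (Suc n) x"
proof (induction n arbitrary: x)
  case (Suc n)
  show ?case using Suc[of "T x"] by simp
qed simp

lemma max_sum_mono: "m \<le> n \<Longrightarrow> max_sum T f m x \<le> max_sum T f n x"
  by (rule lift_Suc_mono_le[of "\<lambda>n. max_sum T f n x"]) (rule max_sum_le_Suc)

section \<open>Maximal inequality and pointwise ergodic theorem\<close>

context mps
begin

lemma integrable_max_sum:
  assumes "integrable M f"
  shows "integrable M (max_sum T f n)"
proof (induction n)
  case 0
  have "max_sum T f 0 = f" by (rule ext) simp
  then show ?case using assms by simp
next
  case (Suc n)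
  then have "integrable M (\<lambda>x. max_sum T f n (T x))"
    using integrable_funpow[of _ 1] by simp
  then have "integrable M (\<lambda>x. f x + max 0 (max_sum T f n (T x)))"
    using assms by (intro Bochner_Integration.integrable_add integrable_max integrable_zero)
  moreover have "max_sum T f (Suc n) = (\<lambda>x. f x + max 0 (max_sum T f n (T x)))" by (rule ext) simp
  ultimately show ?case by (simp only:)
qed

text \<open>On the invariant set \<open>A\<close> where the maximal sums \<open>F\<^sub>n\<close> are unbounded,
  \<open>F\<^sub>n\<^sub>+\<^sub>1 - F\<^sub>n \<circ> T\<close> decreases to \<open>f\<close>, and its integral over \<open>A\<close> is that of
  \<open>F\<^sub>n\<^sub>+\<^sub>1 - F\<^sub>n \<ge> 0\<close>.\<close>

lemma AE_max_sum_bounded: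
  assumes f: "integrable M f" and neg: "AE x in M. real_cond_exp M J f x < 0"
  shows "AE x in M. \<exists>C. \<forall>n. max_sum T f n x \<le> C"
proof -
  interpret J: sigma_finite_subalgebra M J by (rule sigma_finite_subalgebra_J)
  define F where "F = max_sum T f"
  define A where "A = {x \<in> space M. \<forall>C::nat. \<exists>n. F n x > real C}"
  have F_int [simp]: "integrable M (F n)" for n
    unfolding F_def by (rule integrable_max_sum[OF f])
  have [measurable]: "F n \<in> borel_measurable M" "f \<in> borel_measurable M" for n
    by (rule borel_measurable_integrable, rule F_int, rule borel_measurable_integrable, rule f)
  have A_sets [measurable]: "A \<in> sets M" unfolding A_def by measurable
  have F_Suc: "F (Suc n) x = f x + max 0 (F n (T x))" for n x
    by (simp add: F_def)
  \<comment> \<open>As soon as \<open>F n (T x)\<close> is positive, \<open>F (Suc n) x\<close>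
    exceeds it by the fixed amount \<open>f x\<close>, so both sequences are bounded or both are
    unbounded.\<close>
  have unbounded_iff: "(\<forall>C::nat. \<exists>n. F n (T x) > real C) \<longleftrightarrow> (\<forall>C::nat. \<exists>n. F n x > real C)" for x
  proof safe
    fix C assume "\<forall>C::nat. \<exists>n. F n (T x) > real C"
    then obtain n where "F n (T x) > real (nat \<lceil>C - f x\<rceil>)" by blast
    then have "F (Suc n) x > C" unfolding F_Suc by linarith
    then show "\<exists>n. F n x > C" ..
  next
    fix C :: nat assume "\<forall>C::nat. \<exists>n. F n x > real C"
    then obtain n where "F n x > real (nat \<lceil>C + f x\<rceil>)" by blast
    moreover have "F n x \<le> F (Suc n) x" unfolding F_def by (rule max_sum_le_Suc)
    ultimately have "F n (T x) > C" unfolding F_Suc by linarith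
    then show "\<exists>n. F n (T x) > C" ..
  qed
  have TA: "T x \<in> A \<longleftrightarrow> x \<in> A" if "x \<in> space M" for x
    using that T_space[OF that] unbounded_iff[of x] by (simp add: A_def)
  have "A \<subseteq> space M" by (auto simp: A_def)
  have "T -` A \<inter> space M = A"
  proof (intro equalityI subsetI)
    show "x \<in> A" if "x \<in> T -` A \<inter> space M" for x
      using TA[of x] that by simp
    show "x \<in> T -` A \<inter> space M" if "x \<in> A" for x
      using TA[of x] that \<open>A \<subseteq> space M\<close> by auto
  qed
  then have A_J: "A \<in> sets J" by (simp add: sets_J)
  have int_A [simp]: "integrable M (\<lambda>x. indicator A x * h x)" if "integrable M h" for h :: "'a \<Rightarrow> real"
    using integrable_mult_indicator[OF A_sets that] by simp
  have FT_int [simp]: "integrable M (\<lambda>x. F n (T x))" for n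
    using integrable_funpow[of "F n" 1] by simp
  have nonneg: "0 \<le> (\<integral>x. indicator A x * (f x + max (- F n (T x)) 0) \<partial>M)" for n
  proof -
    have "(\<integral>x. indicator A x * F n (T x) \<partial>M) = (\<integral>x. indicator A (T x) * F n (T x) \<partial>M)"
      by (intro Bochner_Integration.integral_cong) (auto simp: indicator_def TA)
    also have "\<dots> = (\<integral>x. indicator A x * F n x \<partial>M)"
      using integral_funpow[of "\<lambda>x. indicator A x * F n x" 1] by simp
    finally have shift: "(\<integral>x. indicator A x * F n (T x) \<partial>M) = (\<integral>x. indicator A x * F n x \<partial>M)" .
    have "0 \<le> (\<integral>x. indicator A x * (F (Suc n) x - F n x) \<partial>M)"
      by (intro Bochner_Integration.integral_nonneg mult_nonneg_nonneg)
         (auto simp: F_def max_sum_le_Suc simp del: max_sum.simps)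
    also have "\<dots> = (\<integral>x. indicator A x * F (Suc n) x \<partial>M) - (\<integral>x. indicator A x * F n (T x) \<partial>M)"
      unfolding shift by (simp add: right_diff_distrib)
    also have "\<dots> = (\<integral>x. indicator A x * F (Suc n) x - indicator A x * F n (T x) \<partial>M)"
      by simp
    also have "\<dots> = (\<integral>x. indicator A x * (f x + max (- F n (T x)) 0) \<partial>M)"
      unfolding F_Suc by (intro Bochner_Integration.integral_cong) (auto simp: algebra_simps max_def)
    finally show ?thesis .
  qed
  have fT: "integrable M (\<lambda>x. f (T x))"
    using integrable_funpow[OF f, of 1] by simp
  have "(\<lambda>n. \<integral>x. indicator A x * (f x + max (- F n (T x)) 0) \<partial>M) \<longlonglongrightarrow> (\<integral>x. indicator A x * f x \<partial>M)"
  proof (rule integral_dominated_convergence[where w = "\<lambda>x. \<bar>f x\<bar> + \<bar>f (T x)\<bar>"])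
    show "integrable M (\<lambda>x. \<bar>f x\<bar> + \<bar>f (T x)\<bar>)" using f fT by simp
    show "AE x in M. (\<lambda>n. indicator A x * (f x + max (- F n (T x)) 0)) \<longlonglongrightarrow> indicator A x * f x"
    proof (rule AE_I2)
      fix x assume x: "x \<in> space M"
      show "(\<lambda>n. indicator A x * (f x + max (- F n (T x)) 0)) \<longlonglongrightarrow> indicator A x * f x"
      proof (cases "x \<in> A")
        case True
        then have "T x \<in> A" using TA[OF x] by simp
        then obtain m where m: "F m (T x) > real 0" unfolding A_def by blast
        have "F n (T x) > 0" if "n \<ge> m" for n
          using max_sum_mono[OF that, of T f "T x"] m unfolding F_def by simp
        then have "\<forall>\<^sub>F n in sequentially. indicator A x * f x = indicator A x * (f x + max (- F n (T x)) 0)"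
          by (intro eventually_sequentiallyI[of m]) (simp add: max_absorb2 less_imp_le)
        then show ?thesis by (rule Lim_transform_eventually[OF tendsto_const])
      qed simp
    qed
    show "AE x in M. norm (indicator A x * (f x + max (- F n (T x)) 0)) \<le> \<bar>f x\<bar> + \<bar>f (T x)\<bar>" for n
    proof (rule AE_I2)
      fix x
      have "f (T x) \<le> F n (T x)"
        using max_sum_mono[of 0 n T f "T x"] unfolding F_def by simp
      then have "\<bar>f x + max (- F n (T x)) 0\<bar> \<le> \<bar>f x\<bar> + \<bar>f (T x)\<bar>" by linarith
      then show "norm (indicator A x * (f x + max (- F n (T x)) 0)) \<le> \<bar>f x\<bar> + \<bar>f (T x)\<bar>"
        by (simp add: indicator_def)
    qed
  qed (use fT in measurable)
  then have "0 \<le> (\<integral>x. indicator A x * f x \<partial>M)"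
    by (rule LIMSEQ_le_const) (intro exI[of _ 0] allI impI nonneg)
  \<comment> \<open>Invariance of \<open>A\<close> allows \<open>f\<close> to be replaced by its
    conditional expectation. That is negative almost everywhere, so a nonnegative integral over
    \<open>A\<close> forces \<open>A\<close> to be a null set.\<close>
  also have "\<dots> = (\<integral>x. indicator A x * real_cond_exp M J f x \<partial>M)"
    using J.real_cond_exp_intA[OF f A_J] by (simp add: set_lebesgue_integral_def)
  finally have ge: "0 \<le> (\<integral>x. indicator A x * real_cond_exp M J f x \<partial>M)" .
  have Ef: "integrable M (\<lambda>x. indicator A x * real_cond_exp M J f x)"
    by (intro int_A J.real_cond_exp_int f)
  have le0: "AE x in M. 0 \<le> - (indicator A x * real_cond_exp M J f x)"
    using neg by eventually_elim (auto simp: indicator_def)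
  have "(\<integral>x. - (indicator A x * real_cond_exp M J f x) \<partial>M) = 0"
    using ge integral_nonneg_AE[OF le0] Ef by simp
  then have "AE x in M. - (indicator A x * real_cond_exp M J f x) = 0"
    using integral_nonneg_eq_0_iff_AE[OF _ le0] Ef by simp
  with neg AE_space show ?thesis
  proof eventually_elim
    case (elim x)
    then have "x \<notin> A" by (auto simp: indicator_def split: if_splits)
    then have "\<exists>C::nat. \<forall>n. F n x \<le> real C" using elim by (auto simp: A_def not_less)
    then show ?case unfolding F_def by blast
  qed
qed

text \<open>Subtracting the conditional expectation and \<open>e\<close> from \<open>g\<close>
  leaves a function of conditional expectation \<open>- e\<close>, whose Birkhoff sums are bounded
  above by some \<open>C\<close> depending on \<open>x\<close>. The averages of \<open>g\<close>
  then exceed the conditional expectation by at most \<open>e + C / n\<close>; the second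
  \<open>e\<close> absorbs \<open>C / n\<close>.\<close>

lemma AE_eventually_average_le:
  assumes g: "integrable M g" and e: "e > 0"
  shows "AE x in M. \<forall>\<^sub>F n in sequentially. (\<Sum>k<n. g ((T ^^ k) x)) / n \<le> real_cond_exp M J g x + 2 * e"
proof -
  interpret J: sigma_finite_subalgebra M J by (rule sigma_finite_subalgebra_J)
  let ?E = "real_cond_exp M J"
  define f where "f x = g x - (?E g x + e)" for x
  have Eg: "integrable M (?E g)" by (rule J.real_cond_exp_int(1)[OF g])
  have Ege: "integrable M (\<lambda>x. ?E g x + e)" using Eg by simp
  have f: "integrable M f" unfolding f_def by (intro Bochner_Integration.integrable_diff g Ege)
  have inv: "(\<lambda>x. ?E g x + e) \<in> borel_measurable J" by simp
  have "AE x in M. ?E f x = ?E g x - ?E (\<lambda>x. ?E g x + e) x"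
    unfolding f_def by (rule J.real_cond_exp_diff[OF g Ege])
  moreover have "AE x in M. ?E (\<lambda>x. ?E g x + e) x = ?E g x + e"
    by (rule J.real_cond_exp_F_meas[OF Ege inv])
  ultimately have "AE x in M. ?E f x < 0"
    by eventually_elim (use e in simp)
  from AE_max_sum_bounded[OF f this] AE_space show ?thesis
  proof eventually_elim
    case (elim x)
    then obtain C where C: "max_sum T f n x \<le> C" for n by blast
    have "(\<Sum>k<n. g ((T ^^ k) x)) / n \<le> ?E g x + 2 * e" if n: "n \<ge> Suc (nat \<lceil>C / e\<rceil>)" for n
    proof -
      obtain m where m: "n = Suc m" using n by (cases n) auto
      have "(\<Sum>k<n. f ((T ^^ k) x)) \<le> C"
        using sum_le_max_sum[of m m f T x] C[of m] unfolding m by simp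
      moreover have "f ((T ^^ k) x) = g ((T ^^ k) x) - (?E g x + e)" for k
        unfolding f_def using invariant_function_funpow[OF inv elim(2), of k] by simp
      ultimately have "(\<Sum>k<n. g ((T ^^ k) x)) \<le> C + n * (?E g x + e)"
        by (simp add: sum_subtractf)
      moreover have "C / e \<le> n" using n by linarith
      then have "C \<le> n * e" using e by (simp add: field_simps)
      ultimately have "(\<Sum>k<n. g ((T ^^ k) x)) \<le> n * (?E g x + 2 * e)"
        by (simp add: algebra_simps)
      then show ?thesis using m by (simp add: field_simps)
    qed
    then show ?case by (rule eventually_sequentiallyI)
  qed
qed

text \<open>The one-sided bound for \<open>g\<close> and for \<open>- g\<close> encloses the
  averages. The errors run through the countable set of \<open>2 / (m + 1)\<close>, so that a single
  null set suffices.\<close>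

theorem birkhoff_ergodic:
  assumes g: "integrable M g"
  shows "AE x in M. (\<lambda>n. (\<Sum>k<n. g ((T ^^ k) x)) / n) \<longlonglongrightarrow> real_cond_exp M J g x"
proof -
  interpret J: sigma_finite_subalgebra M J by (rule sigma_finite_subalgebra_J)
  let ?E = "real_cond_exp M J" and ?S = "\<lambda>g n x. (\<Sum>k<n. g ((T ^^ k) x))"
  have "AE x in M. \<forall>m::nat. \<forall>\<^sub>F n in sequentially. ?S g n x / n \<le> ?E g x + 2 * inverse (Suc m)"
    unfolding AE_all_countable by (intro allI AE_eventually_average_le g) simp
  moreover have "AE x in M. \<forall>m::nat. \<forall>\<^sub>F n in sequentially.
      ?S (\<lambda>x. - g x) n x / n \<le> ?E (\<lambda>x. - g x) x + 2 * inverse (Suc m)"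
    unfolding AE_all_countable using g by (intro allI AE_eventually_average_le) simp_all
  moreover have "AE x in M. ?E (\<lambda>x. - g x) x = - ?E g x"
    using J.real_cond_exp_cmult[OF g, of "-1"] by simp
  ultimately show ?thesis
  proof eventually_elim
    case (elim x)
    show ?case
    proof (rule LIMSEQ_I)
      fix r :: real assume "r > 0"
      then obtain m where m: "inverse (Suc m) < r / 2" using reals_Archimedean[of "r / 2"] by auto
      have "\<forall>\<^sub>F n in sequentially. norm (?S g n x / n - ?E g x) < r"
        using elim(1)[rule_format, of m] elim(2)[rule_format, of m]
        by eventually_elim (use m elim(3) in \<open>auto simp: sum_negf abs_less_iff\<close>)
      then show "\<exists>no. \<forall>n\<ge>no. norm (?S g n x / n - ?E g x) < r"
        by (simp add: eventually_sequentially)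
    qed
  qed
qed

end

section \<open>A sufficient condition for exactness\<close>

lemma norm_add_power2_le: "(norm (x + y))\<^sup>2 \<le> 2 * (norm x)\<^sup>2 + 2 * (norm y)\<^sup>2"
  for x y :: "'b :: real_normed_vector"
proof -
  have "(norm (x + y))\<^sup>2 \<le> (norm x + norm y)\<^sup>2"
    by (intro power_mono norm_triangle_ineq norm_ge_zero)
  also have "\<dots> \<le> 2 * (norm x)\<^sup>2 + 2 * (norm y)\<^sup>2"
    using sum_squares_bound[of "norm x" "norm y"] by (simp add: power2_sum)
  finally show ?thesis .
qed

lemma norm_diff_power2_le: "(norm (x - y))\<^sup>2 \<le> 2 * (norm x)\<^sup>2 + 2 * (norm y)\<^sup>2"
  for x y :: "'b :: real_normed_vector"
  using norm_add_power2_le[of x "- y"] by simp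

lemma norm_sum_power2_le: "(norm (\<Sum>k<n. v k))\<^sup>2 \<le> n * (\<Sum>k<n. (norm (v k))\<^sup>2)"
  for v :: "nat \<Rightarrow> 'b :: real_normed_vector"
proof -
  have "(norm (\<Sum>k<n. v k))\<^sup>2 \<le> (\<Sum>k<n. norm (v k))\<^sup>2"
    by (intro power_mono norm_sum norm_ge_zero)
  also have "\<dots> \<le> (\<Sum>k<n. (norm (v k))\<^sup>2) * card {..<n}"
    by (rule sum_squared_le_sum_of_squares)
  finally show ?thesis by (simp add: mult.commute)
qed

text \<open>Index pairs are grouped by their difference \<open>h\<close>. Doubling accounts for both
  orders of a pair but counts the diagonal \<open>h = 0\<close> twice.\<close>

lemma sum_square_symmetric:
  fixes F :: "nat \<Rightarrow> nat \<Rightarrow> real"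
  assumes sym: "\<And>n m. F n m = F m n"
  shows "(\<Sum>n<N. \<Sum>m<N. F n m) = 2 * (\<Sum>h<N. \<Sum>n<N-h. F n (n + h)) - (\<Sum>n<N. F n n)"
proof (induction N)
  case (Suc N)
  have "(\<Sum>n<Suc N. \<Sum>m<Suc N. F n m) = (\<Sum>n<N. \<Sum>m<N. F n m) + 2 * (\<Sum>n<N. F n N) + F N N"
  proof -
    have "(\<Sum>m<N. F N m) = (\<Sum>n<N. F n N)" by (rule sum.cong[OF refl sym])
    then show ?thesis by (simp add: sum.distrib)
  qed
  moreover have "(\<Sum>h<Suc N. \<Sum>n<Suc N-h. F n (n + h)) = (\<Sum>h<N. \<Sum>n<N-h. F n (n + h)) + (\<Sum>h<Suc N. F (N - h) N)"
  proof -
    have "(\<Sum>h<Suc N. \<Sum>n<Suc N-h. F n (n + h)) = (\<Sum>h<Suc N. (\<Sum>n<N-h. F n (n + h)) + F (N - h) N)"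
      by (rule sum.cong) (auto simp: Suc_diff_le)
    then show ?thesis by (simp add: sum.distrib)
  qed
  moreover have "(\<Sum>h<Suc N. F (N - h) N) = (\<Sum>n<Suc N. F n N)"
    using sum.nat_diff_reindex[of "\<lambda>n. F n N" "Suc N"] by simp
  ultimately show ?case using Suc by simp
qed simp

definition autocorrelation_sum :: "(nat \<Rightarrow> real) \<Rightarrow> nat \<Rightarrow> real" where
  "autocorrelation_sum a N = (\<Sum>h<N. \<bar>\<Sum>n<N-h. a n * a (n + h)\<bar>)"

text \<open>The scalar analogue of the weighted bound for systems, corresponding to the one-point
  system with \<open>g = 1\<close>. It yields the density of the set.\<close>

lemma sum_power2_le_autocorrelation_sum: "(\<Sum>n<N. a n)\<^sup>2 \<le> 2 * autocorrelation_sum a N"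
proof -
  have "(\<Sum>n<N. a n)\<^sup>2 = (\<Sum>n<N. \<Sum>m<N. a n * a m)"
    by (simp add: power2_eq_square sum_product)
  also have "\<dots> = 2 * (\<Sum>h<N. \<Sum>n<N-h. a n * a (n + h)) - (\<Sum>n<N. a n * a n)"
    by (rule sum_square_symmetric) simp
  also have "\<dots> \<le> 2 * (\<Sum>h<N. \<Sum>n<N-h. a n * a (n + h))"
    by (simp add: sum_nonneg)
  also have "\<dots> \<le> 2 * autocorrelation_sum a N"
    unfolding autocorrelation_sum_def by (intro mult_left_mono sum_mono) auto
  finally show ?thesis .
qed

section \<open>Mean ergodic theorem and weighted ergodic sums\<close>

context mps
begin

lemma integrable_norm_power2_sum:
  fixes v :: "nat \<Rightarrow> 'a \<Rightarrow> 'b :: {banach, second_countable_topology}"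
  assumes [measurable]: "\<And>k. v k \<in> borel_measurable M" and v: "\<And>k. integrable M (\<lambda>x. (norm (v k x))\<^sup>2)"
  shows "integrable M (\<lambda>x. (norm (\<Sum>k<n. v k x))\<^sup>2)"
proof (rule Bochner_Integration.integrable_bound)
  show "integrable M (\<lambda>x. n * (\<Sum>k<n. (norm (v k x))\<^sup>2))" using v by simp
  show "AE x in M. norm ((norm (\<Sum>k<n. v k x))\<^sup>2) \<le> norm (n * (\<Sum>k<n. (norm (v k x))\<^sup>2))"
    by (rule AE_I2) (use norm_sum_power2_le[where n = n] in \<open>simp add: abs_of_nonneg sum_nonneg\<close>)
qed measurable

lemma cond_exp_square_integrable:
  assumes [measurable]: "g \<in> borel_measurable M" and g: "integrable M (\<lambda>x. (g x)\<^sup>2)"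
  shows "integrable M (\<lambda>x. (real_cond_exp M J g x)\<^sup>2)"
proof -
  interpret J: sigma_finite_subalgebra M J by (rule sigma_finite_subalgebra_J)
  show ?thesis
    by (rule J.integrable_convex_cond_exp[where I = UNIV])
       (use g square_integrable_imp_integrable[OF assms] convex_power2 in \<open>auto\<close>)
qed

text \<open>Deduced from the pointwise theorem, which identifies the limit as the conditional
  expectation at once. The squared error is at most twice the average of the squared modulus of
  \<open>g\<close> plus twice that of the limit, and this majorant has constant integral.\<close>

lemma mean_ergodic:
  fixes g :: "'a \<Rightarrow> complex"
  assumes [measurable]: "g \<in> borel_measurable M" and g: "integrable M (\<lambda>x. (norm (g x))\<^sup>2)"
  shows "integrable M (\<lambda>x. (norm (complex_cond_exp M J g x))\<^sup>2)"
    and "(\<lambda>n. \<integral>x. (norm ((\<Sum>k<n. g ((T ^^ k) x)) / of_nat n - complex_cond_exp M J g x))\<^sup>2 \<partial>M) \<longlonglongrightarrow> 0"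
proof -
  interpret J: sigma_finite_subalgebra M J by (rule sigma_finite_subalgebra_J)
  define E where "E = complex_cond_exp M J g"
  have E_eq: "E x = Complex (real_cond_exp M J (\<lambda>y. Re (g y)) x) (real_cond_exp M J (\<lambda>y. Im (g y)) x)" for x
    by (simp add: E_def complex_cond_exp_def)
  have E_meas [measurable]: "E \<in> borel_measurable M"
    unfolding borel_measurable_complex_iff by (simp add: E_eq)
  have sq: "integrable M (\<lambda>x. (Re (g x))\<^sup>2)" "integrable M (\<lambda>x. (Im (g x))\<^sup>2)"
    by (rule Bochner_Integration.integrable_bound[OF g]; simp add: cmod_def)+
  have int: "integrable M (\<lambda>x. Re (g x))" "integrable M (\<lambda>x. Im (g x))"
    by (rule square_integrable_imp_integrable, simp, rule sq)+
  have E_sq: "integrable M (\<lambda>x. (norm (E x))\<^sup>2)"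
    unfolding E_eq cmod_power2 complex.sel
    by (intro Bochner_Integration.integrable_add cond_exp_square_integrable sq) auto
  then show "integrable M (\<lambda>x. (norm (complex_cond_exp M J g x))\<^sup>2)" by (simp add: E_def)
  let ?G = "\<lambda>x. (norm (g x))\<^sup>2"
  let ?u = "\<lambda>n x. (norm ((\<Sum>k<n. g ((T ^^ k) x)) / of_nat n - E x))\<^sup>2"
  define H where "H n x = 2 * ((\<Sum>k<n. ?G ((T ^^ k) x)) / n) + 2 * (norm (E x))\<^sup>2" for n x
  have G_int: "integrable M (\<lambda>x. ?G ((T ^^ k) x))" for k
    by (rule integrable_funpow[OF g])
  \<comment> \<open>Index 0 is left out: the empty average is 0 by the convention for division, so
    \<open>H 0\<close> need not have the same integral as the other \<open>H n\<close>.\<close>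
  have "(\<lambda>n. \<integral>x. ?u (Suc n) x \<partial>M) \<longlonglongrightarrow> 0"
  proof (rule integral_tendsto_0_dominated_convergent[where H = "\<lambda>n. H (Suc n)"
        and h = "\<lambda>x. 2 * real_cond_exp M J ?G x + 2 * (norm (E x))\<^sup>2"])
    show "?u (Suc n) x \<le> H (Suc n) x" for n x
    proof -
      have "(norm ((\<Sum>k<Suc n. g ((T ^^ k) x)) / of_nat (Suc n)))\<^sup>2
          = (norm (\<Sum>k<Suc n. g ((T ^^ k) x)))\<^sup>2 / (real (Suc n))\<^sup>2"
        by (simp add: norm_divide power_divide del: of_nat_Suc sum.lessThan_Suc)
      also have "\<dots> \<le> (real (Suc n) * (\<Sum>k<Suc n. ?G ((T ^^ k) x))) / (real (Suc n))\<^sup>2"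
        by (intro divide_right_mono norm_sum_power2_le) simp
      also have "\<dots> = (\<Sum>k<Suc n. ?G ((T ^^ k) x)) / Suc n"
        by (simp add: power2_eq_square del: of_nat_Suc sum.lessThan_Suc)
      finally show ?thesis
        using norm_diff_power2_le[of "(\<Sum>k<Suc n. g ((T ^^ k) x)) / of_nat (Suc n)" "E x"]
        unfolding H_def by linarith
    qed
    show "integrable M (H (Suc n))" for n
      unfolding H_def using E_sq G_int
      by (intro Bochner_Integration.integrable_add integrable_mult_right integrable_divide Bochner_Integration.integrable_sum) auto
    show "integrable M (\<lambda>x. 2 * real_cond_exp M J ?G x + 2 * (norm (E x))\<^sup>2)"
      using J.real_cond_exp_int(1)[OF g] E_sq by simp
    show "(\<integral>x. H (Suc n) x \<partial>M) = (\<integral>x. 2 * real_cond_exp M J ?G x + 2 * (norm (E x))\<^sup>2 \<partial>M)" for n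
    proof -
      have "(\<integral>x. H (Suc n) x \<partial>M) = 2 * ((\<Sum>k<Suc n. \<integral>x. ?G ((T ^^ k) x) \<partial>M) / Suc n) + 2 * (\<integral>x. (norm (E x))\<^sup>2 \<partial>M)"
        unfolding H_def using E_sq G_int
        by (simp del: sum.lessThan_Suc of_nat_Suc)
      also have "(\<Sum>k<Suc n. \<integral>x. ?G ((T ^^ k) x) \<partial>M) = (\<Sum>k<Suc n. \<integral>x. ?G x \<partial>M)"
        by (intro sum.cong integral_funpow) auto
      also have "(\<integral>x. ?G x \<partial>M) = (\<integral>x. real_cond_exp M J ?G x \<partial>M)"
        using J.real_cond_exp_int(2)[OF g] by simp
      finally show ?thesis
        using J.real_cond_exp_int(1)[OF g] E_sq by (simp del: sum.lessThan_Suc of_nat_Suc)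
    qed
    show "AE x in M. (\<lambda>n. H (Suc n) x) \<longlonglongrightarrow> 2 * real_cond_exp M J ?G x + 2 * (norm (E x))\<^sup>2"
      using birkhoff_ergodic[OF g]
    proof eventually_elim
      case (elim x)
      have "(\<lambda>n. H n x) \<longlonglongrightarrow> 2 * real_cond_exp M J ?G x + 2 * (norm (E x))\<^sup>2"
        unfolding H_def by (intro tendsto_intros elim)
      then show ?case by (rule LIMSEQ_Suc)
    qed
    show "AE x in M. (\<lambda>n. ?u (Suc n) x) \<longlonglongrightarrow> 0"
      using birkhoff_ergodic[OF int(1)] birkhoff_ergodic[OF int(2)]
    proof eventually_elim
      case (elim x)
      have "(\<lambda>n. (\<Sum>k<n. g ((T ^^ k) x)) / of_nat n) \<longlonglongrightarrow> E x"
        unfolding tendsto_complex_iff E_eq using elim by simp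
      then have "(\<lambda>n. ?u n x) \<longlonglongrightarrow> (norm (E x - E x))\<^sup>2"
        by (intro tendsto_intros)
      then show ?case by (intro LIMSEQ_Suc) simp
    qed
  qed auto
  then show "(\<lambda>n. \<integral>x. (norm ((\<Sum>k<n. g ((T ^^ k) x)) / of_nat n - complex_cond_exp M J g x))\<^sup>2 \<partial>M) \<longlonglongrightarrow> 0"
    unfolding E_def by (rule LIMSEQ_imp_Suc)
qed

text \<open>Invariance of the measure makes the correlation of \<open>g \<circ> T ^^ n\<close> and
  \<open>g \<circ> T ^^ (n + h)\<close> a number \<open>r h\<close> that depends on the lag only,
  and it is at most the squared norm of \<open>g\<close>. The inner product is the real one on the
  complex plane; it is symmetric, and it suffices because the weights are real.\<close>

lemma integral_norm_weighted_sum_le: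
  fixes g :: "'a \<Rightarrow> complex"
  assumes [measurable]: "g \<in> borel_measurable M" and g: "integrable M (\<lambda>x. (norm (g x))\<^sup>2)"
  shows "(\<integral>x. (norm (\<Sum>n<N. a n *\<^sub>R g ((T ^^ n) x)))\<^sup>2 \<partial>M) \<le> 2 * autocorrelation_sum a N * (\<integral>x. (norm (g x))\<^sup>2 \<partial>M)"
proof -
  let ?I = "\<integral>x. (norm (g x))\<^sup>2 \<partial>M"
  let ?p = "\<lambda>n m x. g ((T ^^ n) x) \<bullet> g ((T ^^ m) x)"
  define r where "r h = (\<integral>x. ?p 0 h x \<partial>M)" for h
  have bound: "\<bar>?p n m x\<bar> \<le> (norm (g ((T ^^ n) x)))\<^sup>2 / 2 + (norm (g ((T ^^ m) x)))\<^sup>2 / 2" for n m x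
    using Cauchy_Schwarz_ineq2[of "g ((T ^^ n) x)" "g ((T ^^ m) x)"]
      sum_squares_bound[of "norm (g ((T ^^ n) x))" "norm (g ((T ^^ m) x))"] by simp
  have bound_int: "integrable M (\<lambda>x. (norm (g ((T ^^ n) x)))\<^sup>2 / 2 + (norm (g ((T ^^ m) x)))\<^sup>2 / 2)" for n m
    using integrable_funpow[OF g] by simp
  have p_int [simp]: "integrable M (?p n m)" for n m
    by (rule Bochner_Integration.integrable_bound[OF bound_int[of n m]])
       (use bound[of n _ m] in \<open>auto intro!: AE_I2 simp: abs_of_nonneg\<close>)
  have shift: "(\<integral>x. ?p n (n + h) x \<partial>M) = r h" for n h
    using integral_funpow[of "?p 0 h" n] by (simp add: r_def funpow_add add.commute[of n h])
  have "\<bar>r h\<bar> \<le> (\<integral>x. (norm (g x))\<^sup>2 / 2 + (norm (g ((T ^^ h) x)))\<^sup>2 / 2 \<partial>M)" for h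
    unfolding r_def using bound[of 0 _ h] p_int[of 0 h] bound_int[of 0 h]
    by (intro order_trans[OF integral_abs_bound] integral_mono) auto
  moreover have "(\<integral>x. (norm (g x))\<^sup>2 / 2 + (norm (g ((T ^^ h) x)))\<^sup>2 / 2 \<partial>M) = ?I" for h
    using integrable_funpow[OF g] g integral_funpow[of "\<lambda>x. (norm (g x))\<^sup>2" h] by simp
  ultimately have r_le: "\<bar>r h\<bar> \<le> ?I" for h by simp
  have "(\<integral>x. (norm (\<Sum>n<N. a n *\<^sub>R g ((T ^^ n) x)))\<^sup>2 \<partial>M) = (\<integral>x. (\<Sum>n<N. \<Sum>m<N. a n * a m * ?p n m x) \<partial>M)"
    unfolding power2_norm_eq_inner inner_sum_left inner_sum_right
    by (subst sum.swap) (simp add: inner_commute mult_ac)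
  also have "\<dots> = (\<Sum>n<N. \<Sum>m<N. a n * a m * (\<integral>x. ?p n m x \<partial>M))"
    by simp
  also have "\<dots> = 2 * (\<Sum>h<N. \<Sum>n<N-h. a n * a (n + h) * (\<integral>x. ?p n (n + h) x \<partial>M))
      - (\<Sum>n<N. a n * a n * (\<integral>x. ?p n n x \<partial>M))"
    by (rule sum_square_symmetric) (simp add: inner_commute mult.commute)
  also have "\<dots> \<le> 2 * (\<Sum>h<N. \<Sum>n<N-h. a n * a (n + h) * (\<integral>x. ?p n (n + h) x \<partial>M))"
    by (simp add: sum_nonneg)
  also have "\<dots> = 2 * (\<Sum>h<N. (\<Sum>n<N-h. a n * a (n + h)) * r h)"
    by (simp add: shift sum_distrib_right)
  also have "\<dots> \<le> 2 * (\<Sum>h<N. \<bar>\<Sum>n<N-h. a n * a (n + h)\<bar> * ?I)"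
  proof (intro mult_left_mono sum_mono)
    show "(\<Sum>n<N-h. a n * a (n + h)) * r h \<le> \<bar>\<Sum>n<N-h. a n * a (n + h)\<bar> * ?I" for h
      by (rule order_trans[OF abs_ge_self]) (simp add: abs_mult mult_left_mono r_le)
  qed simp
  also have "\<dots> = 2 * autocorrelation_sum a N * ?I"
    by (simp add: autocorrelation_sum_def sum_distrib_right)
  finally show ?thesis .
qed

end

section \<open>From weighted averages to averages along a set\<close>

lemma measure_preserving_system_iff_mps: "measure_preserving_system M T \<longleftrightarrow> mps M T"
  by (simp add: measure_preserving_system_def mps_def mps_axioms_def)

text \<open>The cut-off \<open>enumerate \<Lambda> N\<close> is the first place below which exactly
  \<open>N\<close> elements of \<Lambda> lie. For the constant function 1 this computes the counting
  function there.\<close>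

lemma sum_enumerate:
  fixes \<Lambda> :: "nat set" and v :: "nat \<Rightarrow> 'b :: real_vector"
  assumes "infinite \<Lambda>"
  shows "(\<Sum>n<N. v (enumerate \<Lambda> n)) = (\<Sum>m<enumerate \<Lambda> N. indicat_real \<Lambda> m *\<^sub>R v m)"
proof -
  have mono: "strict_mono (enumerate \<Lambda>)" by (rule strict_mono_enumerate[OF assms])
  have "enumerate \<Lambda> ` {..<N} = {..<enumerate \<Lambda> N} \<inter> \<Lambda>"
  proof (intro equalityI subsetI)
    fix m assume "m \<in> {..<enumerate \<Lambda> N} \<inter> \<Lambda>"
    then obtain n where "m = enumerate \<Lambda> n" "enumerate \<Lambda> n < enumerate \<Lambda> N"
      using enumerate_Ex[OF assms] by blast
    then show "m \<in> enumerate \<Lambda> ` {..<N}"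
      using strict_mono_less[OF mono] by auto
  qed (use enumerate_in_set[OF assms] strict_mono_less[OF mono] in auto)
  then have "(\<Sum>n<N. v (enumerate \<Lambda> n)) = (\<Sum>m\<in>{..<enumerate \<Lambda> N} \<inter> \<Lambda>. v m)"
    using sum.reindex[of "enumerate \<Lambda>" "{..<N}" v] strict_mono_imp_inj_on[OF mono, THEN inj_on_subset]
    by (metis comp_apply subset_UNIV sum.cong)
  also have "\<dots> = (\<Sum>m<enumerate \<Lambda> N. indicat_real \<Lambda> m *\<^sub>R v m)"
    by (rule sum.mono_neutral_cong_left) (auto simp: indicator_def)
  finally show ?thesis .
qed

lemma LIMSEQ_density:
  fixes a :: "nat \<Rightarrow> real"
  assumes "(\<lambda>N. autocorrelation_sum a N / (real N)\<^sup>2) \<longlonglongrightarrow> 0"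
  shows "(\<lambda>N. (\<Sum>n<N. a n) / N) \<longlonglongrightarrow> 0"
proof -
  have "(\<lambda>N. ((\<Sum>n<N. a n) / N)\<^sup>2) \<longlonglongrightarrow> 0"
  proof (rule tendsto_sandwich[OF _ _ tendsto_const])
    show "(\<lambda>N. 2 * (autocorrelation_sum a N / (real N)\<^sup>2)) \<longlonglongrightarrow> 0"
      using tendsto_mult_left[OF assms, of 2] by simp
    have "((\<Sum>n<N. a n) / N)\<^sup>2 \<le> 2 * (autocorrelation_sum a N / (real N)\<^sup>2)" for N
      using divide_right_mono[OF sum_power2_le_autocorrelation_sum[of a N], of "(real N)\<^sup>2"]
      by (simp add: power_divide)
    then show "\<forall>\<^sub>F N in sequentially. ((\<Sum>n<N. a n) / N)\<^sup>2 \<le> 2 * (autocorrelation_sum a N / (real N)\<^sup>2)"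
      by (intro always_eventually allI)
  qed simp
  then have "(\<lambda>N. sqrt (((\<Sum>n<N. a n) / N)\<^sup>2)) \<longlonglongrightarrow> sqrt 0"
    by (rule tendsto_real_sqrt)
  then show ?thesis
    unfolding real_sqrt_abs real_sqrt_zero by (rule tendsto_rabs_zero_cancel)
qed

text \<open>At \<open>L = enumerate \<Lambda> N\<close> the average along \<Lambda> is
  \<open>L / N\<close> times the ordinary average up to \<open>L\<close> of
  \<open>g \<circ> T ^^ m\<close> weighted by the indicator, and the indicator is
  \<open>a + s\<close>. The \<open>a\<close> part vanishes by the autocorrelation bound, the
  constant part converges by the mean ergodic theorem, and \<open>L / N\<close> tends to
  \<open>1 / s\<close> by the density statement. Positive density also makes \<Lambda>
  infinite.\<close>

lemma L2_exactI:
  assumes s: "s > 0"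
    and lim: "(\<lambda>N. autocorrelation_sum (\<lambda>n. indicat_real \<Lambda> n - s) N / (real N)\<^sup>2) \<longlonglongrightarrow> 0"
  shows "L2_exact TYPE('x) \<Lambda>"
  unfolding L2_exact_def
proof (intro conjI allI impI)
  define a where "a n = indicat_real \<Lambda> n - s" for n
  define D where "D N = (\<Sum>n<N. indicat_real \<Lambda> n)" for N
  have lim_a: "(\<lambda>N. autocorrelation_sum a N / (real N)\<^sup>2) \<longlonglongrightarrow> 0"
    using lim unfolding a_def .
  have D_eq: "(\<Sum>n<N. a n) = D N - N * s" for N
    by (simp add: a_def D_def sum_subtractf)
  have "(\<lambda>N. (\<Sum>n<N. a n) / N + s) \<longlonglongrightarrow> 0 + s"
    by (intro tendsto_intros LIMSEQ_density lim_a)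
  moreover have "\<forall>\<^sub>F N in sequentially. (\<Sum>n<N. a n) / N + s = D N / N"
    by (rule eventually_sequentiallyI[of 1]) (simp add: D_eq field_simps)
  ultimately have D_lim: "(\<lambda>N. D N / N) \<longlonglongrightarrow> s"
    by (auto intro: Lim_transform_eventually)
  show inf: "infinite \<Lambda>"
  proof
    assume fin: "finite \<Lambda>"
    have "D N \<le> card \<Lambda>" for N
    proof -
      have "D N = (\<Sum>n\<in>{..<N} \<inter> \<Lambda>. 1)"
        unfolding D_def by (rule sum.mono_neutral_cong_right) (auto simp: indicator_def)
      then show ?thesis using card_mono[OF fin, of "{..<N} \<inter> \<Lambda>"] by simp
    qed
    then have "D N / N \<le> card \<Lambda> / N" for N by (intro divide_right_mono) auto
    moreover have "(\<lambda>N. card \<Lambda> / real N) \<longlonglongrightarrow> 0" by (rule lim_const_over_n)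
    ultimately have "s \<le> 0" by (intro LIMSEQ_le[OF D_lim, of _ 0]) auto
    then show False using s by simp
  qed
  fix M :: "'x measure" and T and g :: "'x \<Rightarrow> complex"
  assume "measure_preserving_system M T" and g_meas [measurable]: "g \<in> borel_measurable M"
    and g: "integrable M (\<lambda>x. (norm (g x))\<^sup>2)"
  then interpret mps M T by (simp add: measure_preserving_system_iff_mps)
  define E where "E = complex_cond_exp M J g"
  define W where "W L x = (\<Sum>n<L. a n *\<^sub>R g ((T ^^ n) x))" for L x
  define R where "R L x = (\<Sum>n<L. g ((T ^^ n) x)) / of_nat L - E x" for L x
  define c where "c L = real L / D L" for L
  \<comment> \<open>The three error sources: weighted sum, mean ergodic error, density error.
    Splitting a squared norm of a sum twice produces the factors 4, 4 and 2.\<close>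
  define B where "B L x = 4 * (c L)\<^sup>2 * (norm (W L x) / L)\<^sup>2 + 4 * (c L * s)\<^sup>2 * (norm (R L x))\<^sup>2
     + 2 * (c L * s - 1)\<^sup>2 * (norm (E x))\<^sup>2" for L x
  let ?g2 = "\<integral>x. (norm (g x))\<^sup>2 \<partial>M"
  have E_meas [measurable]: "E \<in> borel_measurable M"
    unfolding borel_measurable_complex_iff E_def complex_cond_exp_def by simp
  have E_sq: "integrable M (\<lambda>x. (norm (E x))\<^sup>2)"
    unfolding E_def by (rule mean_ergodic(1)[OF g_meas g])
  have g_sq: "integrable M (\<lambda>x. (norm (g ((T ^^ n) x)))\<^sup>2)" for n
    by (rule integrable_funpow[OF g])
  have W_sq: "integrable M (\<lambda>x. (norm (W L x))\<^sup>2)" for L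
    unfolding W_def by (intro integrable_norm_power2_sum) (auto simp: power_mult_distrib g_sq)
  have R_sq: "integrable M (\<lambda>x. (norm (R L x))\<^sup>2)" for L
  proof (rule Bochner_Integration.integrable_bound)
    show "integrable M (\<lambda>x. 2 * ((norm (\<Sum>n<L. g ((T ^^ n) x)))\<^sup>2 / (real L)\<^sup>2) + 2 * (norm (E x))\<^sup>2)"
      by (intro Bochner_Integration.integrable_add integrable_mult_right integrable_divide
          integrable_norm_power2_sum E_sq g_sq) measurable
    show "AE x in M. norm ((norm (R L x))\<^sup>2) \<le> norm (2 * ((norm (\<Sum>n<L. g ((T ^^ n) x)))\<^sup>2 / (real L)\<^sup>2) + 2 * (norm (E x))\<^sup>2)"
      unfolding R_def
    proof (rule AE_I2)
      fix x
      show "norm ((norm ((\<Sum>n<L. g ((T ^^ n) x)) / of_nat L - E x))\<^sup>2)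
          \<le> norm (2 * ((norm (\<Sum>n<L. g ((T ^^ n) x)))\<^sup>2 / (real L)\<^sup>2) + 2 * (norm (E x))\<^sup>2)"
        using norm_diff_power2_le[of "(\<Sum>n<L. g ((T ^^ n) x)) / of_nat L" "E x"]
        by (simp add: norm_divide power_divide)
    qed
  qed (simp add: R_def)
  have B_int: "integrable M (B L)" for L
    unfolding B_def power_divide
    by (intro Bochner_Integration.integrable_add integrable_mult_right integrable_divide W_sq R_sq E_sq)
  have B_nonneg: "0 \<le> B L x" for L x
    unfolding B_def by simp
  have c_lim: "c \<longlonglongrightarrow> 1 / s"
    using tendsto_inverse[OF D_lim] s by (simp add: c_def[abs_def] inverse_eq_divide)
  have "(\<lambda>L. \<integral>x. B L x \<partial>M) \<longlonglongrightarrow> 0"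
  proof (rule tendsto_sandwich[OF _ _ tendsto_const])
    let ?b = "\<lambda>L. 4 * (c L)\<^sup>2 * (2 * (autocorrelation_sum a L / (real L)\<^sup>2) * ?g2)
      + 4 * (c L * s)\<^sup>2 * (\<integral>x. (norm (R L x))\<^sup>2 \<partial>M) + 2 * (c L * s - 1)\<^sup>2 * (\<integral>x. (norm (E x))\<^sup>2 \<partial>M)"
    have "?b \<longlonglongrightarrow> 4 * (1 / s)\<^sup>2 * (2 * 0 * ?g2) + 4 * (1 / s * s)\<^sup>2 * 0 + 2 * (1 / s * s - 1)\<^sup>2 * (\<integral>x. (norm (E x))\<^sup>2 \<partial>M)"
      by (intro tendsto_intros c_lim lim_a) (unfold R_def E_def, rule mean_ergodic(2)[OF g_meas g])
    then show "?b \<longlonglongrightarrow> 0" using s by simp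
    have "(\<integral>x. B L x \<partial>M) \<le> ?b L" for L
    proof -
      have "(\<integral>x. B L x \<partial>M) = 4 * (c L)\<^sup>2 * ((\<integral>x. (norm (W L x))\<^sup>2 \<partial>M) / (real L)\<^sup>2)
        + 4 * (c L * s)\<^sup>2 * (\<integral>x. (norm (R L x))\<^sup>2 \<partial>M) + 2 * (c L * s - 1)\<^sup>2 * (\<integral>x. (norm (E x))\<^sup>2 \<partial>M)"
        unfolding B_def power_divide using W_sq R_sq E_sq by simp
      moreover have "(\<integral>x. (norm (W L x))\<^sup>2 \<partial>M) / (real L)\<^sup>2 \<le> 2 * (autocorrelation_sum a L / (real L)\<^sup>2) * ?g2"
        using divide_right_mono[OF integral_norm_weighted_sum_le[OF g_meas g, of a L], of "(real L)\<^sup>2"]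
        by (simp add: W_def)
      then have "4 * (c L)\<^sup>2 * ((\<integral>x. (norm (W L x))\<^sup>2 \<partial>M) / (real L)\<^sup>2)
          \<le> 4 * (c L)\<^sup>2 * (2 * (autocorrelation_sum a L / (real L)\<^sup>2) * ?g2)"
        by (intro mult_left_mono) auto
      ultimately show ?thesis by linarith
    qed
    then show "\<forall>\<^sub>F L in sequentially. (\<integral>x. B L x \<partial>M) \<le> ?b L" by (intro always_eventually allI)
    show "\<forall>\<^sub>F L in sequentially. 0 \<le> (\<integral>x. B L x \<partial>M)"
      by (intro always_eventually allI Bochner_Integration.integral_nonneg B_nonneg)
  qed
  moreover have "filterlim (enumerate \<Lambda>) sequentially sequentially"
    by (rule filterlim_subseq[OF strict_mono_enumerate[OF inf]])
  ultimately have "(\<lambda>N. \<integral>x. B (enumerate \<Lambda> N) x \<partial>M) \<longlonglongrightarrow> 0"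
    by (rule filterlim_compose)
  then have "(\<lambda>N. ennreal (\<integral>x. B (enumerate \<Lambda> N) x \<partial>M)) \<longlonglongrightarrow> ennreal 0"
    by (rule tendsto_ennrealI)
  then have upper: "(\<lambda>N. ennreal (\<integral>x. B (enumerate \<Lambda> N) x \<partial>M)) \<longlonglongrightarrow> 0" by simp
  let ?u = "\<lambda>N x. (\<Sum>n<N. g ((T ^^ enumerate \<Lambda> n) x)) / of_nat N - complex_cond_exp M J g x"
  have le: "(\<integral>\<^sup>+x. ennreal ((norm (?u N x))\<^sup>2) \<partial>M) \<le> ennreal (\<integral>x. B (enumerate \<Lambda> N) x \<partial>M)" if N: "N \<ge> 1" for N
  proof -
    let ?L = "enumerate \<Lambda> N"
    have L: "?L > 0" using le_enumerate[OF inf, of N] N by simp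
    have D_L: "D ?L = N"
      using sum_enumerate[OF inf, of "\<lambda>_. 1 :: real" N] by (simp add: D_def)
    have "(norm (?u N x))\<^sup>2 \<le> B ?L x" for x
    proof -
      have "(\<Sum>n<N. g ((T ^^ enumerate \<Lambda> n) x)) = (\<Sum>m<?L. indicat_real \<Lambda> m *\<^sub>R g ((T ^^ m) x))"
        by (rule sum_enumerate[OF inf])
      also have "\<dots> = W ?L x + s *\<^sub>R (\<Sum>m<?L. g ((T ^^ m) x))"
        by (simp add: W_def a_def scaleR_diff_left sum_subtractf scaleR_sum_right)
      also have "(\<Sum>m<?L. g ((T ^^ m) x)) = of_nat ?L * (R ?L x + E x)"
        using L by (simp add: R_def)
      finally have "?u N x = (c ?L *\<^sub>R (W ?L x / of_nat ?L) + (c ?L * s) *\<^sub>R R ?L x) + (c ?L * s - 1) *\<^sub>R E x"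
        using L N by (simp add: c_def D_L E_def[symmetric] scaleR_conv_of_real field_simps)
      then have "(norm (?u N x))\<^sup>2 \<le> 2 * (norm (c ?L *\<^sub>R (W ?L x / of_nat ?L) + (c ?L * s) *\<^sub>R R ?L x))\<^sup>2
          + 2 * (norm ((c ?L * s - 1) *\<^sub>R E x))\<^sup>2"
        by (simp only: norm_add_power2_le)
      also have "\<dots> \<le> 2 * (2 * (norm (c ?L *\<^sub>R (W ?L x / of_nat ?L)))\<^sup>2 + 2 * (norm ((c ?L * s) *\<^sub>R R ?L x))\<^sup>2)
          + 2 * (norm ((c ?L * s - 1) *\<^sub>R E x))\<^sup>2"
        by (intro add_right_mono mult_left_mono norm_add_power2_le) simp
      also have "\<dots> = B ?L x"
        by (simp add: B_def power_mult_distrib power_divide norm_divide)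
      finally show ?thesis .
    qed
    then have "(\<integral>\<^sup>+x. ennreal ((norm (?u N x))\<^sup>2) \<partial>M) \<le> (\<integral>\<^sup>+x. ennreal (B ?L x) \<partial>M)"
      by (intro nn_integral_mono ennreal_leI)
    also have "\<dots> = ennreal (\<integral>x. B ?L x \<partial>M)"
      by (rule nn_integral_eq_integral[OF B_int]) (simp add: B_nonneg)
    finally show ?thesis .
  qed
  show "(\<lambda>N. \<integral>\<^sup>+x. ennreal ((norm (?u N x))\<^sup>2) \<partial>M) \<longlonglongrightarrow> 0"
    by (rule tendsto_sandwich[OF _ _ tendsto_const upper])
       (use le in \<open>auto intro!: eventually_sequentiallyI[of 1]\<close>)
qed

section \<open>Consequences of exactness\<close>

lemma L2_exactD:
  assumes "L2_exact TYPE('x) \<Lambda>" "mps M T" "g \<in> borel_measurable M" "integrable M (\<lambda>x. (norm (g x))\<^sup>2)"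
  shows "(\<lambda>N. \<integral>\<^sup>+x. ennreal ((norm ((\<Sum>n<N. g ((T ^^ enumerate \<Lambda> n) x)) / of_nat N
      - complex_cond_exp M (invariant_algebra M T) g x))\<^sup>2) \<partial>(M :: 'x measure)) \<longlonglongrightarrow> 0"
  using assms(1) unfolding L2_exact_def
  by (elim conjE allE[of _ M] allE[of _ T] allE[of _ g] impE)
     (simp_all add: measure_preserving_system_iff_mps assms(2-4))

text \<open>If all returns along \<Lambda> were null, then at almost every point of \<open>A\<close>
  at most one term of the average of the indicator would be nonzero, so the limit, the conditional
  expectation, would vanish on \<open>A\<close>. Then \<open>A\<close> lies, up to a null set, in
  the invariant set where the conditional expectation is 0, and integrating over that set gives
  \<open>A\<close> measure 0.\<close>

lemma recurrent_if_L2_exact: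
  assumes exact: "L2_exact TYPE('x) \<Lambda>"
  shows "recurrent TYPE('x) \<Lambda>"
  unfolding recurrent_def
proof (intro conjI allI impI)
  show inf: "infinite \<Lambda>" using exact by (simp add: L2_exact_def)
  fix M :: "'x measure" and T and A
  assume sys: "measure_preserving_system M T" and A [measurable]: "A \<in> sets M" and pos: "measure M A > 0"
  interpret mps M T using sys by (simp add: measure_preserving_system_iff_mps)
  interpret J: sigma_finite_subalgebra M J by (rule sigma_finite_subalgebra_J)
  show "\<exists>n\<in>\<Lambda>. n \<ge> 1 \<and> measure M (A \<inter> (T ^^ n) -` A) > 0"
  proof (rule ccontr)
    assume "\<not> ?thesis"
    then have null: "measure M (A \<inter> (T ^^ n) -` A) = 0" if "n \<in> \<Lambda>" "n \<ge> 1" for n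
      using that by (auto simp: not_less measure_le_0_iff)
    let ?g = "\<lambda>x. complex_of_real (indicat_real A x)"
    let ?u = "\<lambda>N x. (\<Sum>n<N. ?g ((T ^^ enumerate \<Lambda> n) x)) / of_nat N"
    let ?e = "real_cond_exp M J (indicat_real A)"
    let ?E = "complex_cond_exp M J ?g"
    have Re_E: "Re (?E x) = ?e x" for x
      by (simp add: complex_cond_exp_def)
    have [measurable]: "?E \<in> borel_measurable M"
      unfolding borel_measurable_complex_iff complex_cond_exp_def by simp
    have "(\<lambda>N. \<integral>\<^sup>+x. ennreal ((norm (?u N x - ?E x))\<^sup>2) \<partial>M) \<longlonglongrightarrow> 0"
    proof -
      have "integrable M (\<lambda>x. (norm (?g x))\<^sup>2)"
        by (rule integrable_const_bound[where B = 1]) (auto simp: indicator_def)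
      then show ?thesis by (intro L2_exactD[OF exact mps_axioms]) auto
    qed
    \<comment> \<open>Convergence in mean square gives pointwise convergence only along a
      subsequence; Fatou's lemma for the limes inferior avoids extracting one.\<close>
    then have "liminf (\<lambda>N. \<integral>\<^sup>+x. ennreal ((norm (?u N x - ?E x))\<^sup>2) \<partial>M) = 0"
      by (intro lim_imp_Liminf) auto
    moreover have "(\<integral>\<^sup>+x. liminf (\<lambda>N. ennreal ((norm (?u N x - ?E x))\<^sup>2)) \<partial>M) \<le>
        liminf (\<lambda>N. \<integral>\<^sup>+x. ennreal ((norm (?u N x - ?E x))\<^sup>2) \<partial>M)"
      by (rule nn_integral_liminf) measurable
    ultimately have "(\<integral>\<^sup>+x. liminf (\<lambda>N. ennreal ((norm (?u N x - ?E x))\<^sup>2)) \<partial>M) = 0"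
      by simp
    then have liminf_0: "AE x in M. liminf (\<lambda>N. ennreal ((norm (?u N x - ?E x))\<^sup>2)) = 0"
      by (subst (asm) nn_integral_0_iff_AE) measurable
    have "AE x in M. \<forall>n. n \<in> \<Lambda> \<and> n \<ge> 1 \<longrightarrow> \<not> (x \<in> A \<and> (T ^^ n) x \<in> A)"
      unfolding AE_all_countable
    proof
      fix n
      show "AE x in M. n \<in> \<Lambda> \<and> n \<ge> 1 \<longrightarrow> \<not> (x \<in> A \<and> (T ^^ n) x \<in> A)"
      proof (cases "n \<in> \<Lambda> \<and> n \<ge> 1")
        case True
        have "A \<inter> (T ^^ n) -` A = A \<inter> ((T ^^ n) -` A \<inter> space M)"
          using sets.sets_into_space[OF A] by blast
        then have "A \<inter> (T ^^ n) -` A \<in> sets M"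
          using measurable_sets[OF funpow_measurable A] by auto
        then have "A \<inter> (T ^^ n) -` A \<in> null_sets M"
          using null[of n] True by (simp add: null_sets_def emeasure_eq_measure)
        from AE_not_in[OF this] show ?thesis by eventually_elim auto
      qed auto
    qed
    with liminf_0 have zero: "AE x in M. x \<in> A \<longrightarrow> ?e x = 0"
    proof eventually_elim
      case (elim x)
      show ?case
      proof
        assume x: "x \<in> A"
        have ind: "indicat_real A ((T ^^ n) x) = 0" if "n \<in> \<Lambda>" "n \<ge> 1" for n
          using elim(2) x that by auto
        have "norm (?u N x) \<le> 1 / N" for N
        proof -
          \<comment> \<open>The first element of \<Lambda> may be 0, where nothing is known about
            returns, so its term is bounded by 1. All later elements are at least 1.\<close>
          have "norm (\<Sum>n<N. ?g ((T ^^ enumerate \<Lambda> n) x)) \<le> (\<Sum>n<N. if n = 0 then 1 else 0)"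
          proof (intro order_trans[OF norm_sum] sum_mono)
            fix n
            have "indicat_real A ((T ^^ enumerate \<Lambda> n) x) = 0" if "n \<noteq> 0"
              using le_enumerate[OF inf, of n] that by (intro ind enumerate_in_set[OF inf]) auto
            then show "norm (?g ((T ^^ enumerate \<Lambda> n) x)) \<le> (if n = 0 then 1 else 0)"
              by (auto simp: indicator_def)
          qed
          also have "\<dots> \<le> 1" by (simp add: sum.delta)
          finally show ?thesis by (simp add: norm_divide divide_right_mono)
        qed
        then have "(\<lambda>N. ?u N x) \<longlonglongrightarrow> 0"
          by (intro Lim_null_comparison[OF _ lim_1_over_n] always_eventually allI)
        then have "(\<lambda>N. ennreal ((norm (?u N x - ?E x))\<^sup>2)) \<longlonglongrightarrow> ennreal ((norm (0 - ?E x))\<^sup>2)"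
          by (intro tendsto_intros)
        then have "liminf (\<lambda>N. ennreal ((norm (?u N x - ?E x))\<^sup>2)) = ennreal ((norm (0 - ?E x))\<^sup>2)"
          by (intro lim_imp_Liminf) auto
        then have "?E x = 0" using elim(1) by simp
        then show "?e x = 0" using Re_E[of x] by simp
      qed
    qed
    let ?B = "{x \<in> space M. ?e x = 0}"
    have "?B = ?e -` {0} \<inter> space J" by (auto simp: space_J)
    then have B_J: "?B \<in> sets J" using measurable_sets[of ?e J borel "{0}"] by simp
    then have [measurable]: "?B \<in> sets M" by (simp add: sets_J)
    have "(\<integral>x\<in>?B. indicat_real A x \<partial>M) = (\<integral>x\<in>?B. ?e x \<partial>M)"
      by (intro J.real_cond_exp_intA[OF _ B_J] integrable_const_bound[where B = 1]) auto
    also have "\<dots> = 0"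
      unfolding set_lebesgue_integral_def by (rule integral_eq_zero_AE) (auto simp: indicator_def)
    finally have "(\<integral>x\<in>?B. indicat_real A x \<partial>M) = 0" .
    moreover have "(\<integral>x\<in>?B. indicat_real A x \<partial>M) = (\<integral>x. indicat_real A x \<partial>M)"
      unfolding set_lebesgue_integral_def
    proof (rule integral_cong_AE)
      show "AE x in M. indicat_real ?B x *\<^sub>R indicat_real A x = indicat_real A x"
        using zero AE_space by eventually_elim (auto simp: indicator_def)
    qed measurable
    ultimately show False using pos by simp
  qed
qed

section \<open>Independence of the underlying type of the system\<close>

lemma (in prob_space) expectation_power2_le:
  assumes "integrable M f" "integrable M (\<lambda>x. (f x :: real)\<^sup>2)"
  shows "(expectation f)\<^sup>2 \<le> expectation (\<lambda>x. (f x)\<^sup>2)"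
  using variance_eq[OF assms] variance_positive[of f] by simp

definition shift :: "(nat \<Rightarrow> 'b) \<Rightarrow> nat \<Rightarrow> 'b" where
  "shift y n = y (Suc n)"

lemma funpow_shift: "(shift ^^ k) y n = y (n + k)"
  by (induction k arbitrary: n) (auto simp: shift_def)

text \<open>The orbit map \<open>x \<mapsto> (g (T\<^sup>n x))\<^sub>n\<close> realises the pair \<open>(T, g)\<close> as a factor: a shift on
  sequences together with the coordinate projection.\<close>

lemma L2_exact_transfer:
  assumes exact: "L2_exact TYPE(nat \<Rightarrow> complex) \<Lambda>"
  shows "L2_exact TYPE('x) \<Lambda>"
  unfolding L2_exact_def
proof (intro conjI allI impI)
  show "infinite \<Lambda>" using exact by (simp add: L2_exact_def)
  fix M :: "'x measure" and T and g :: "'x \<Rightarrow> complex"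
  assume "measure_preserving_system M T" and g_meas [measurable]: "g \<in> borel_measurable M"
    and g: "integrable M (\<lambda>x. (norm (g x))\<^sup>2)"
  then interpret mps M T by (simp add: measure_preserving_system_iff_mps)
  interpret J: sigma_finite_subalgebra M J by (rule sigma_finite_subalgebra_J)
  define \<phi> where "\<phi> x n = g ((T ^^ n) x)" for x n
  let ?Seq = "PiM UNIV (\<lambda>_. borel) :: (nat \<Rightarrow> complex) measure"
  define N where "N = distr M ?Seq \<phi>"
  have \<phi>_meas [measurable]: "\<phi> \<in> measurable M ?Seq"
    by (rule measurable_PiM_single') (auto simp: \<phi>_def[abs_def])
  have shift_meas: "shift \<in> measurable ?Seq ?Seq"
    by (rule measurable_PiM_single') (auto simp: shift_def)
  have sets_N: "sets N = sets ?Seq" by (simp add: N_def)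
  have space_N: "space N = UNIV" by (simp add: N_def space_PiM)
  have shift_\<phi>: "shift (\<phi> x) = \<phi> (T x)" for x
    by (simp add: fun_eq_iff shift_def \<phi>_def funpow_swap1)
  have "distr N N shift = distr N ?Seq shift"
    by (rule distr_cong) (simp_all add: sets_N)
  also have "\<dots> = distr M ?Seq (shift \<circ> \<phi>)"
    unfolding N_def by (rule distr_distr[OF shift_meas \<phi>_meas])
  also have "shift \<circ> \<phi> = \<phi> \<circ> T" by (simp add: fun_eq_iff shift_\<phi>)
  also have "distr M ?Seq (\<phi> \<circ> T) = distr (distr M M T) ?Seq \<phi>"
    by (rule distr_distr[symmetric]) measurable
  finally have "distr N N shift = N" by (simp add: T_preserving N_def)
  moreover have "shift \<in> measurable N N"
    using shift_meas by (simp add: measurable_cong_sets[OF sets_N sets_N])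
  moreover have "prob_space N" unfolding N_def by (rule prob_space_distr[OF \<phi>_meas])
  ultimately have mps_N: "mps N shift" by (simp add: mps_def mps_axioms_def)
  interpret N: mps N shift by (rule mps_N)
  interpret NJ: sigma_finite_subalgebra N N.J by (rule N.sigma_finite_subalgebra_J)
  let ?p = "\<lambda>y :: nat \<Rightarrow> complex. y 0"
  have p_Seq: "?p \<in> borel_measurable ?Seq" by measurable
  then have p_meas: "?p \<in> borel_measurable N" by (simp add: measurable_cong_sets[OF sets_N refl])
  have \<phi>_N: "\<phi> \<in> measurable M N" by (simp add: measurable_cong_sets[OF refl sets_N])
  have N_eq: "distr M N \<phi> = N" unfolding N_def by (rule distr_cong) simp_all
  have p_sq: "integrable N (\<lambda>y. (norm (?p y))\<^sup>2)"
  proof -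
    have "(\<lambda>y. (norm (?p y))\<^sup>2) \<in> borel_measurable ?Seq" by measurable
    then show ?thesis
      using g unfolding N_def by (subst integrable_distr_eq[OF \<phi>_meas]) (simp_all add: \<phi>_def)
  qed
  define E where "E = complex_cond_exp N N.J ?p"
  have Re_E_J: "(\<lambda>y. Re (E y)) \<in> borel_measurable N.J" and Im_E_J: "(\<lambda>y. Im (E y)) \<in> borel_measurable N.J"
    by (simp_all add: E_def complex_cond_exp_def)
  have E_meas: "E \<in> borel_measurable N"
    unfolding borel_measurable_complex_iff E_def complex_cond_exp_def by simp
  have E_sq: "integrable N (\<lambda>y. (norm (E y))\<^sup>2)"
    unfolding E_def by (rule N.mean_ergodic(1)[OF p_meas p_sq])
  define h where "h x = E (\<phi> x)" for x
  have h_meas [measurable]: "h \<in> borel_measurable M"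
    unfolding h_def by (rule measurable_compose[OF \<phi>_N E_meas])
  have h_sq: "integrable M (\<lambda>x. (norm (h x))\<^sup>2)"
    using integrable_distr[OF \<phi>_N, of "\<lambda>y. (norm (E y))\<^sup>2"] E_sq by (simp add: N_eq h_def)
  define v where "v K x = (\<Sum>n<K. g ((T ^^ enumerate \<Lambda> n) x)) / of_nat K" for K x
  have v_meas [measurable]: "v K \<in> borel_measurable M" for K unfolding v_def by measurable
  have g_sq: "integrable M (\<lambda>x. (norm (g ((T ^^ n) x)))\<^sup>2)" for n
    by (rule integrable_funpow[OF g])
  have v_sq: "integrable M (\<lambda>x. (norm (v K x))\<^sup>2)" for K
    unfolding v_def norm_divide power_divide
    by (intro integrable_divide integrable_norm_power2_sum g_sq) measurable
  have conv: "(\<lambda>K. \<integral>\<^sup>+x. ennreal ((norm (v K x - h x))\<^sup>2) \<partial>M) \<longlonglongrightarrow> 0"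
  proof -
    have "(\<lambda>K. \<integral>\<^sup>+y. ennreal ((norm ((\<Sum>n<K. ?p ((shift ^^ enumerate \<Lambda> n) y)) / of_nat K - E y))\<^sup>2) \<partial>N) \<longlonglongrightarrow> 0"
      unfolding E_def by (rule L2_exactD[OF exact mps_N p_meas p_sq])
    moreover have "(\<integral>\<^sup>+y. ennreal ((norm ((\<Sum>n<K. ?p ((shift ^^ enumerate \<Lambda> n) y)) / of_nat K - E y))\<^sup>2) \<partial>N)
        = (\<integral>\<^sup>+x. ennreal ((norm (v K x - h x))\<^sup>2) \<partial>M)" for K
    proof -
      let ?F = "\<lambda>y. ennreal ((norm ((\<Sum>n<K. ?p ((shift ^^ enumerate \<Lambda> n) y)) / of_nat K - E y))\<^sup>2)"
      have "(\<lambda>y. ?p ((shift ^^ k) y)) \<in> borel_measurable N" for k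
        by (rule measurable_compose[OF N.funpow_measurable p_meas])
      then have "?F \<in> borel_measurable N" using E_meas by measurable
      then have "(\<integral>\<^sup>+y. ?F y \<partial>N) = (\<integral>\<^sup>+x. ?F (\<phi> x) \<partial>M)"
        using nn_integral_distr[OF \<phi>_N, of ?F] by (simp add: N_eq)
      then show ?thesis by (simp add: funpow_shift v_def h_def \<phi>_def)
    qed
    ultimately show ?thesis by simp
  qed
  \<comment> \<open>Preimages of shift-invariant sets may a priori form a smaller \<sigma>-algebra
    than \<open>J\<close>, so conditioning on the factor need not obviously agree with conditioning
    on \<open>J\<close>. Exactness settles this: the averages along \<Lambda> have the same integral
    as \<open>g\<close> over every set of \<open>J\<close>, and these integrals pass to the limit
    \<open>h\<close>. Here \<pi> stands for real or imaginary part.\<close>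
  have cond_exp_eq: "AE x in M. real_cond_exp M J (\<lambda>x. \<pi> (g x)) x = \<pi> (h x)"
    if \<pi>: "bounded_linear \<pi>" and \<pi>_le: "\<And>z. \<bar>\<pi> z\<bar> \<le> norm z" and \<pi>E: "(\<lambda>y. \<pi> (E y)) \<in> borel_measurable N.J"
    for \<pi> :: "complex \<Rightarrow> real"
  proof -
    interpret \<pi>: bounded_linear \<pi> by (rule \<pi>)
    have \<pi>_meas [measurable]: "\<pi> \<in> borel_measurable borel"
      by (intro borel_measurable_continuous_onI linear_continuous_on \<pi>)
    have \<pi>_sq_le: "(\<pi> z)\<^sup>2 \<le> (norm z)\<^sup>2" for z
      using power_mono[OF \<pi>_le[of z], of 2] by simp
    have \<pi>_sq: "integrable M (\<lambda>x. (\<pi> (w x))\<^sup>2)"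
      if "w \<in> borel_measurable M" "integrable M (\<lambda>x. (norm (w x))\<^sup>2)" for w
    proof (rule Bochner_Integration.integrable_bound[OF that(2)])
      show "AE x in M. norm ((\<pi> (w x))\<^sup>2) \<le> norm ((norm (w x))\<^sup>2)"
        by (intro AE_I2) (simp add: \<pi>_sq_le)
    qed (use that(1) in measurable)
    have \<pi>_int: "integrable M (\<lambda>x. \<pi> (w x))"
      if "w \<in> borel_measurable M" "integrable M (\<lambda>x. (norm (w x))\<^sup>2)" for w
      by (rule square_integrable_imp_integrable[OF _ \<pi>_sq[OF that]]) (use that(1) in measurable)
    show ?thesis
    proof (rule J.real_cond_exp_charact)
      show "integrable M (\<lambda>x. \<pi> (g x))" "integrable M (\<lambda>x. \<pi> (h x))"
        by (rule \<pi>_int[OF g_meas g], rule \<pi>_int[OF h_meas h_sq])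
      \<comment> \<open>\<open>\<pi> \<circ> E\<close> is shift-invariant at every sequence, since
        \<open>space N\<close> is the whole type, and \<phi> intertwines \<open>T\<close> with the
        shift.\<close>
      show "(\<lambda>x. \<pi> (h x)) \<in> borel_measurable J"
        unfolding measurable_J_iff
      proof (intro conjI ballI)
        fix x
        show "\<pi> (h (T x)) = \<pi> (h x)"
          using \<pi>E unfolding N.measurable_J_iff space_N by (simp add: h_def shift_\<phi>[symmetric])
      qed measurable
      fix A assume A: "A \<in> sets J"
      then have [measurable]: "A \<in> sets M" by (simp add: sets_J)
      define c where "c = (\<integral>x. indicator A x * \<pi> (g x) \<partial>M) - (\<integral>x. indicator A x * \<pi> (h x) \<partial>M)"
      \<comment> \<open>The defect \<open>c\<close> does not depend on \<open>K\<close>, yet it is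
        the integral over \<open>A\<close> of \<pi> applied to the error of the \<open>K\<close>-th
        average. That error tends to 0 in mean square. \<open>K = 0\<close> is excluded because
        \<open>v 0\<close> is 0.\<close>
      have "ennreal (c\<^sup>2) \<le> (\<integral>\<^sup>+x. ennreal ((norm (v K x - h x))\<^sup>2) \<partial>M)" if K: "K \<ge> 1" for K
      proof -
        let ?f = "\<lambda>x. indicator A x * \<pi> (v K x - h x)"
        have vh_sq: "integrable M (\<lambda>x. (norm (v K x - h x))\<^sup>2)"
        proof (rule Bochner_Integration.integrable_bound)
          show "integrable M (\<lambda>x. 2 * (norm (v K x))\<^sup>2 + 2 * (norm (h x))\<^sup>2)"
            using v_sq h_sq by simp
          show "AE x in M. norm ((norm (v K x - h x))\<^sup>2) \<le> norm (2 * (norm (v K x))\<^sup>2 + 2 * (norm (h x))\<^sup>2)"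
            by (rule AE_I2) (simp add: norm_diff_power2_le)
        qed measurable
        have f_sq_le: "(?f x)\<^sup>2 \<le> (norm (v K x - h x))\<^sup>2" for x
          using \<pi>_sq_le[of "v K x - h x"] by (simp add: indicator_def)
        have f_sq: "integrable M (\<lambda>x. (?f x)\<^sup>2)"
          by (rule Bochner_Integration.integrable_bound[OF vh_sq]) (measurable, use f_sq_le in simp)
        have int_A: "integrable M (\<lambda>x. indicator A x * \<pi> (w x))"
          if "w \<in> borel_measurable M" "integrable M (\<lambda>x. (norm (w x))\<^sup>2)" for w
          using integrable_mult_indicator[OF \<open>A \<in> sets M\<close> \<pi>_int[OF that]] by simp
        define F where "F k x = indicator A x * \<pi> (g ((T ^^ k) x))" for k x
        have F_int: "integrable M (F k)" for k
          unfolding F_def by (rule int_A[OF _ g_sq]) measurable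
        have F_eq: "(\<integral>x. F k x \<partial>M) = (\<integral>x. indicator A x * \<pi> (g x) \<partial>M)" for k
        proof -
          have "(\<integral>x. F k x \<partial>M) = (\<integral>x. indicator A ((T ^^ k) x) * \<pi> (g ((T ^^ k) x)) \<partial>M)"
            unfolding F_def
            by (intro Bochner_Integration.integral_cong) (auto simp: indicator_def invariant_set_funpow[OF A])
          also have "\<dots> = (\<integral>x. indicator A x * \<pi> (g x) \<partial>M)"
            by (rule integral_funpow) measurable
          finally show ?thesis .
        qed
        have v_eq: "indicator A x * \<pi> (v K x) = (\<Sum>n<K. F (enumerate \<Lambda> n) x) / K" for x
        proof -
          have "v K x = (1 / real K) *\<^sub>R (\<Sum>n<K. g ((T ^^ enumerate \<Lambda> n) x))"
            by (simp add: v_def scaleR_conv_of_real)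
          then have "\<pi> (v K x) = (\<Sum>n<K. \<pi> (g ((T ^^ enumerate \<Lambda> n) x))) / K"
            by (simp add: \<pi>.scaleR \<pi>.sum)
          then show ?thesis by (simp only: F_def sum_distrib_left times_divide_eq_right)
        qed
        have "(\<integral>x. indicator A x * \<pi> (v K x) \<partial>M) = (\<integral>x. indicator A x * \<pi> (g x) \<partial>M)"
          unfolding v_eq using K F_int by (simp add: F_eq)
        then have "c = (\<integral>x. ?f x \<partial>M)"
          using int_A[OF v_meas v_sq, of K] int_A[OF h_meas h_sq]
          by (simp add: c_def \<pi>.diff right_diff_distrib)
        then have "c\<^sup>2 \<le> (\<integral>x. (?f x)\<^sup>2 \<partial>M)"
          using expectation_power2_le[OF square_integrable_imp_integrable[OF _ f_sq] f_sq] by simp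
        also have "\<dots> \<le> (\<integral>x. (norm (v K x - h x))\<^sup>2 \<partial>M)"
          by (intro integral_mono f_sq vh_sq f_sq_le)
        finally have "ennreal (c\<^sup>2) \<le> ennreal (\<integral>x. (norm (v K x - h x))\<^sup>2 \<partial>M)"
          by (rule ennreal_leI)
        also have "\<dots> = (\<integral>\<^sup>+x. ennreal ((norm (v K x - h x))\<^sup>2) \<partial>M)"
          by (rule nn_integral_eq_integral[OF vh_sq, symmetric]) simp
        finally show ?thesis .
      qed
      then have "ennreal (c\<^sup>2) \<le> 0"
        by (intro LIMSEQ_le_const[OF conv] exI[of _ 1] allI impI)
      then have "c = 0" by simp
      then show "(\<integral>x\<in>A. \<pi> (g x) \<partial>M) = (\<integral>x\<in>A. \<pi> (h x) \<partial>M)"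
        by (simp add: c_def set_lebesgue_integral_def)
    qed
  qed
  have "AE x in M. complex_cond_exp M J g x = h x"
    using cond_exp_eq[OF bounded_linear_Re abs_Re_le_cmod Re_E_J]
      cond_exp_eq[OF bounded_linear_Im abs_Im_le_cmod Im_E_J]
    by eventually_elim (simp add: complex_cond_exp_def complex_eq_iff)
  then have "(\<integral>\<^sup>+x. ennreal ((norm (v K x - complex_cond_exp M J g x))\<^sup>2) \<partial>M)
      = (\<integral>\<^sup>+x. ennreal ((norm (v K x - h x))\<^sup>2) \<partial>M)" for K
    by (intro nn_integral_cong_AE) auto
  then show "(\<lambda>K. \<integral>\<^sup>+x. ennreal ((norm ((\<Sum>n<K. g ((T ^^ enumerate \<Lambda> n) x)) / of_nat K
      - complex_cond_exp M J g x))\<^sup>2) \<partial>M) \<longlonglongrightarrow> 0"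
    using conv by (simp add: v_def)
qed

section \<open>Autocorrelations of stationary determinantal processes\<close>

text \<open>Interchanging sum and integral makes the series of the \<open>Z m\<close> finite almost
  everywhere, so its terms tend to 0. This plays the part of Markov's inequality with
  Borel-Cantelli.\<close>

lemma (in prob_space) AE_tendsto_0_if_summable_expectation:
  fixes Z :: "nat \<Rightarrow> 'a \<Rightarrow> real"
  assumes Z: "\<And>m. integrable M (Z m)" "\<And>m x. 0 \<le> Z m x" and sm: "summable (\<lambda>m. expectation (Z m))"
  shows "AE x in M. (\<lambda>m. Z m x) \<longlonglongrightarrow> 0"
proof -
  have [measurable]: "Z m \<in> borel_measurable M" for m using Z(1) by simp
  have "(\<integral>\<^sup>+x. (\<Sum>m. ennreal (Z m x)) \<partial>M) = (\<Sum>m. \<integral>\<^sup>+x. ennreal (Z m x) \<partial>M)"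
    by (rule nn_integral_suminf) measurable
  also have "\<dots> = (\<Sum>m. ennreal (expectation (Z m)))"
    by (intro suminf_cong nn_integral_eq_integral Z) (simp add: Z)
  also have "\<dots> = ennreal (\<Sum>m. expectation (Z m))"
    by (rule suminf_ennreal2) (simp_all add: sm Z Bochner_Integration.integral_nonneg)
  finally have "(\<integral>\<^sup>+x. (\<Sum>m. ennreal (Z m x)) \<partial>M) \<noteq> \<infinity>" by simp
  then have "AE x in M. (\<Sum>m. ennreal (Z m x)) \<noteq> \<infinity>"
    by (intro nn_integral_noteq_infinite) auto
  then show ?thesis
  proof eventually_elim
    case (elim x)
    then have "summable (\<lambda>m. Z m x)"
      by (intro summable_suminf_not_top) (auto simp: Z)
    then show ?case by (rule summable_LIMSEQ_zero)
  qed
qed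

text \<open>Each of the \<open>N + 1\<close> lags gains a single product of modulus at most 1; for
  the new lag \<open>h = N\<close> the old inner sum is empty.\<close>

lemma autocorrelation_sum_Suc_le:
  assumes a: "\<And>n. \<bar>a n\<bar> \<le> 1"
  shows "autocorrelation_sum a (Suc N) \<le> autocorrelation_sum a N + real (Suc N)"
proof -
  have "autocorrelation_sum a (Suc N) \<le> (\<Sum>h<Suc N. \<bar>\<Sum>n<N-h. a n * a (n + h)\<bar> + 1)"
    unfolding autocorrelation_sum_def
  proof (rule sum_mono)
    fix h assume "h \<in> {..<Suc N}"
    then have "(\<Sum>n<Suc N-h. a n * a (n + h)) = (\<Sum>n<N-h. a n * a (n + h)) + a (N - h) * a N"
      by (simp add: Suc_diff_le)
    moreover have "\<bar>a (N - h) * a N\<bar> \<le> 1"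
      using a by (simp add: abs_mult mult_le_one)
    ultimately show "\<bar>\<Sum>n<Suc N-h. a n * a (n + h)\<bar> \<le> \<bar>\<Sum>n<N-h. a n * a (n + h)\<bar> + 1"
      by linarith
  qed
  also have "\<dots> = autocorrelation_sum a N + real (Suc N)"
    by (simp add: autocorrelation_sum_def sum.distrib)
  finally show ?thesis .
qed

lemma autocorrelation_sum_nonneg: "0 \<le> autocorrelation_sum a N"
  unfolding autocorrelation_sum_def by (intro sum_nonneg) simp

text \<open>If \<open>m\<close> is the integer square root of \<open>N\<close>, then
  \<open>N\<close> is at most \<open>2 * m\<close> steps beyond the square, and each step adds at
  most \<open>N\<close>. The total increase \<open>2 * m * N\<close> contributes at most
  \<open>2 / m\<close> after division by the square of \<open>N\<close>.\<close>

lemma LIMSEQ_autocorrelation_sum_of_squares: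
  assumes a: "\<And>n. \<bar>a n\<bar> \<le> 1"
    and lim: "(\<lambda>m. autocorrelation_sum a (m\<^sup>2) / (real m)^4) \<longlonglongrightarrow> 0"
  shows "(\<lambda>N. autocorrelation_sum a N / (real N)\<^sup>2) \<longlonglongrightarrow> 0"
proof -
  let ?Q = "autocorrelation_sum a"
  have add_le: "?Q (N + i) \<le> ?Q N + real i * real (N + i)" for N i
  proof (induction i)
    case (Suc i)
    have "?Q (N + Suc i) \<le> ?Q N + real i * real (N + i) + real (Suc (N + i))"
      using autocorrelation_sum_Suc_le[where a = a and N = "N + i", OF a] Suc by simp
    also have "\<dots> \<le> ?Q N + real (Suc i) * real (N + Suc i)"
      by (simp add: algebra_simps)
    finally show ?case .
  qed simp
  let ?r = "\<lambda>m. ?Q (m\<^sup>2) / (real m)^4 + 2 / real m"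
  have bound: "?Q N / (real N)\<^sup>2 \<le> ?r (floor_sqrt N)" if N: "N \<ge> 1" for N
  proof -
    define m where "m = floor_sqrt N"
    have m: "m\<^sup>2 \<le> N" "N < (Suc m)\<^sup>2" unfolding m_def
      by (rule floor_sqrt_power2_le, rule Suc_floor_sqrt_power2_gt)
    have m_pos: "m > 0" using N m(2) by (cases m) auto
    have rm: "(real m)\<^sup>2 \<le> real N" using m(1) by (metis of_nat_le_iff of_nat_power)
    have "?Q N \<le> ?Q (m\<^sup>2) + real (N - m\<^sup>2) * real N"
      using add_le[of "m\<^sup>2" "N - m\<^sup>2"] m(1) by simp
    also have "\<dots> \<le> ?Q (m\<^sup>2) + real (2 * m) * real N"
      using m(2) by (intro add_left_mono mult_right_mono of_nat_mono) (auto simp: power2_eq_square)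
    finally have "?Q N / (real N)\<^sup>2 \<le> (?Q (m\<^sup>2) + real (2 * m) * real N) / (real N)\<^sup>2"
      by (rule divide_right_mono) simp
    also have "\<dots> = ?Q (m\<^sup>2) / (real N)\<^sup>2 + 2 * real m / real N"
      using N by (simp add: add_divide_distrib power2_eq_square)
    also have "\<dots> \<le> ?Q (m\<^sup>2) / (real m)^4 + 2 * real m / (real m)\<^sup>2"
    proof (intro add_mono divide_left_mono)
      have "((real m)\<^sup>2)\<^sup>2 \<le> (real N)\<^sup>2" by (intro power_mono rm) simp
      then show "(real m)^4 \<le> (real N)\<^sup>2" by simp
    qed (use rm m_pos N autocorrelation_sum_nonneg in auto)
    also have "2 * real m / (real m)\<^sup>2 = 2 / real m"
      using m_pos by (simp add: power2_eq_square)
    finally show ?thesis unfolding m_def .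
  qed
  have "(\<lambda>m. 2 / real m) \<longlonglongrightarrow> 0" by (rule lim_const_over_n)
  then have "?r \<longlonglongrightarrow> 0 + 0" by (intro tendsto_add lim)
  moreover have "filterlim floor_sqrt sequentially sequentially"
    unfolding filterlim_at_top
  proof
    fix Z :: nat
    show "\<forall>\<^sub>F N in sequentially. Z \<le> floor_sqrt N"
      by (rule eventually_sequentiallyI[of "Z\<^sup>2"]) (simp add: le_floor_sqrt_iff)
  qed
  ultimately have "(\<lambda>N. ?r (floor_sqrt N)) \<longlonglongrightarrow> 0"
    using filterlim_compose by fastforce
  then show ?thesis
    by (rule tendsto_sandwich[OF _ _ tendsto_const, rotated 2])
       (use bound autocorrelation_sum_nonneg in \<open>auto intro!: eventually_sequentiallyI[of 1]\<close>)
qed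

section \<open>Covariances and fourth moments in the stationary case\<close>

locale stationary_determinantal_indicators =
  determinantal_indicators P "\<lambda>n m. \<kappa> (n - m)" x s
  for P :: "'w measure" and \<kappa> :: "int \<Rightarrow> complex" and x :: "int \<Rightarrow> 'w \<Rightarrow> real" and s :: real
begin

abbreviation a :: "nat \<Rightarrow> 'w \<Rightarrow> real" where "a n \<omega> \<equiv> x (int n) \<omega> - s"

definition k :: "int \<Rightarrow> real" where "k j = (cmod (\<kappa> j))\<^sup>2"

lemma s_bounds: "0 \<le> s" "s \<le> 1"
proof -
  have "complex_of_real (expectation (x 0)) = complex_of_real s" by (rule expectation_1)
  then have s: "s = expectation (x 0)" by simp
  show "0 \<le> s" unfolding s by (rule Bochner_Integration.integral_nonneg) (rule x_nonneg)
  have "expectation (x 0) \<le> expectation (\<lambda>_. 1)"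
    by (intro integral_mono integrable_prod_indicators) (auto simp: x_le_1)
  then show "s \<le> 1" unfolding s by (simp add: prob_space)
qed

lemma k_nonneg: "0 \<le> k j"
  by (simp add: k_def)

lemma k_minus: "k (- j) = k j"
proof -
  have "\<kappa> (- j) = cnj (\<kappa> j)" using hermitian[of 0 j] by simp
  then show ?thesis by (simp add: k_def)
qed

lemma k_eq: "\<kappa> (n - m) * \<kappa> (m - n) = complex_of_real (k (n - m))"
  using hermitian[of m n] by (simp only: k_def complex_norm_square)

text \<open>For \<open>j \<noteq> 0\<close> the number \<open>s * s - k j\<close> is the expectation
  of a nonnegative product, so \<open>k j\<close> cannot exceed \<open>s * s\<close>.\<close>

lemma k_le_1: "k j \<le> 1"
proof (cases "j = 0")
  case True
  then show ?thesis
    using diagonal[of 0] s_bounds by (simp add: k_def power_le_one)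
next
  case False
  then have "complex_of_real (expectation (\<lambda>\<omega>. x j \<omega> * x 0 \<omega>)) = complex_of_real (s * s - k j)"
    using expectation_2[of j 0] k_eq[of j 0] by simp
  then have "expectation (\<lambda>\<omega>. x j \<omega> * x 0 \<omega>) = s * s - k j" by (simp only: of_real_eq_iff)
  moreover have "0 \<le> expectation (\<lambda>\<omega>. x j \<omega> * x 0 \<omega>)"
    by (intro Bochner_Integration.integral_nonneg) (simp add: x_nonneg)
  moreover have "s * s \<le> 1" using s_bounds by (simp add: mult_le_one)
  ultimately show ?thesis by linarith
qed

lemma abs_centered_le_1: "\<bar>x n \<omega> - s\<bar> \<le> 1"
  using x_nonneg[of n \<omega>] x_le_1[of n \<omega>] s_bounds by linarith

lemma integrable_centered_2 [simp]: "integrable P (\<lambda>\<omega>. (x i \<omega> - s) * (x j \<omega> - s))"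
  by (rule integrable_const_bound[where B = 1]) (simp_all add: abs_mult mult_le_one abs_centered_le_1)

lemma integrable_centered_4 [simp]:
  "integrable P (\<lambda>\<omega>. ((x i \<omega> - s) * (x j \<omega> - s)) * ((x l \<omega> - s) * (x m \<omega> - s)))"
  by (rule integrable_const_bound[where B = 1]) (simp_all add: abs_mult mult_le_one abs_centered_le_1)

text \<open>Since the variance of a partial sum is nonnegative, the negative covariances \<open>- k\<close> are
  summable: this replaces Bessel's inequality for the Fourier coefficients of the kernel.\<close>

lemma sum_k_atMost_le: "(\<Sum>h=1..L. k (int h)) \<le> 1"
proof (cases "L = 0")
  case False
  \<comment> \<open>In a window of length \<open>2 * L\<close> every lag \<open>h \<le> L\<close>
    occurs at least \<open>L\<close> times, while the variances add up to at most
    \<open>2 * L\<close>. Dividing by \<open>L\<close> gives a bound free of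
    \<open>L\<close>.\<close>
  let ?N = "2 * L"
  have cov: "expectation (\<lambda>\<omega>. a n \<omega> * a (n + h) \<omega>) = - k (int h)" if "h \<ge> 1" for n h
  proof -
    have "complex_of_real (expectation (\<lambda>\<omega>. a n \<omega> * a (n + h) \<omega>)) = complex_of_real (- k (int n - int (n + h)))"
      using expectation_centered_2[of "int n" "int (n + h)"] that k_eq[of "int n" "int (n + h)"] by simp
    then have "expectation (\<lambda>\<omega>. a n \<omega> * a (n + h) \<omega>) = - k (- int h)"
      by (simp only: of_real_eq_iff) simp
    then show ?thesis by (simp add: k_minus)
  qed
  have var: "expectation (\<lambda>\<omega>. a n \<omega> * a n \<omega>) \<le> 1" for n
  proof -
    have "expectation (\<lambda>\<omega>. a n \<omega> * a n \<omega>) \<le> expectation (\<lambda>_. 1)"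
    proof (rule integral_mono)
      show "a n \<omega> * a n \<omega> \<le> 1" for \<omega>
        using abs_centered_le_1[of "int n" \<omega>] by (simp only: power2_eq_square[symmetric] abs_square_le_1)
    qed auto
    then show ?thesis by (simp add: prob_space)
  qed
  have "0 \<le> expectation (\<lambda>\<omega>. (\<Sum>n<?N. a n \<omega>)\<^sup>2)"
    by (intro Bochner_Integration.integral_nonneg) simp
  also have "\<dots> = expectation (\<lambda>\<omega>. \<Sum>n<?N. \<Sum>m<?N. a n \<omega> * a m \<omega>)"
    by (simp only: power2_eq_square sum_product)
  also have "\<dots> = (\<Sum>n<?N. \<Sum>m<?N. expectation (\<lambda>\<omega>. a n \<omega> * a m \<omega>))"
    by (simp add: Bochner_Integration.integral_sum)
  also have "\<dots> = 2 * (\<Sum>h<?N. \<Sum>n<?N-h. expectation (\<lambda>\<omega>. a n \<omega> * a (n + h) \<omega>))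
      - (\<Sum>n<?N. expectation (\<lambda>\<omega>. a n \<omega> * a n \<omega>))"
    by (rule sum_square_symmetric) (simp add: mult.commute)
  also have "(\<Sum>h<?N. \<Sum>n<?N-h. expectation (\<lambda>\<omega>. a n \<omega> * a (n + h) \<omega>))
      = (\<Sum>n<?N. expectation (\<lambda>\<omega>. a n \<omega> * a n \<omega>)) - (\<Sum>h=1..<?N. real (?N - h) * k (int h))"
  proof -
    have "{..<?N} = insert 0 {1..<?N}" using False by auto
    moreover have "(\<Sum>h=1..<?N. \<Sum>n<?N-h. expectation (\<lambda>\<omega>. a n \<omega> * a (n + h) \<omega>))
        = - (\<Sum>h=1..<?N. real (?N - h) * k (int h))"
      unfolding sum_negf[symmetric] by (rule sum.cong[OF refl]) (subst cov, auto)
    ultimately show ?thesis by simp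
  qed
  finally have "2 * (\<Sum>h=1..<?N. real (?N - h) * k (int h)) \<le> (\<Sum>n<?N. expectation (\<lambda>\<omega>. a n \<omega> * a n \<omega>))"
    by simp
  also have "\<dots> \<le> (\<Sum>n<?N. 1)" by (intro sum_mono var)
  finally have le: "(\<Sum>h=1..<?N. real (?N - h) * k (int h)) \<le> L" by simp
  have "real L * (\<Sum>h=1..L. k (int h)) = (\<Sum>h=1..L. real L * k (int h))"
    by (simp add: sum_distrib_left)
  also have "\<dots> \<le> (\<Sum>h=1..L. real (?N - h) * k (int h))"
    by (intro sum_mono mult_right_mono k_nonneg) auto
  also have "\<dots> \<le> (\<Sum>h=1..<?N. real (?N - h) * k (int h))"
    using False by (intro sum_mono2) (auto simp: k_nonneg)
  also note le
  finally show ?thesis using False by simp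
qed simp

text \<open>The bound 3 consists of 1 for the value at 0 and 1 for each of the two
  half-lines.\<close>

lemma sum_k_le:
  assumes "finite F"
  shows "(\<Sum>j\<in>F. k j) \<le> 3"
proof -
  have sym: "(\<Sum>j\<in>{- int L..int L}. k j) = k 0 + 2 * (\<Sum>h=1..L. k (int h))" for L
  proof (induction L)
    case (Suc L)
    have "{- int (Suc L)..int (Suc L)} = insert (int (Suc L)) (insert (- int (Suc L)) {- int L..int L})"
      by auto
    then show ?case using Suc k_minus[of "int (Suc L)"] by (simp add: algebra_simps)
  qed simp
  obtain L where L: "\<And>j. j \<in> F \<Longrightarrow> nat \<bar>j\<bar> \<le> L"
    using finite_imageI[OF assms, of "\<lambda>j. nat \<bar>j\<bar>"] unfolding finite_nat_set_iff_bounded_le by blast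
  then have "F \<subseteq> {- int L..int L}" by force
  then have "(\<Sum>j\<in>F. k j) \<le> (\<Sum>j\<in>{- int L..int L}. k j)"
    by (intro sum_mono2) (auto simp: k_nonneg)
  then show ?thesis using sym[of L] sum_k_atMost_le[of L] k_le_1[of 0] by simp
qed

lemma sum_k_reindex_le:
  fixes p :: "nat \<Rightarrow> int"
  assumes "inj_on p {..<N}"
  shows "(\<Sum>m<N. k (p m)) \<le> 3"
  using sum_k_le[OF finite_imageI[OF finite_lessThan], of p N] sum.reindex[OF assms, of k] by simp

text \<open>The four \<open>of_bool\<close> terms take care of the quadruples \<open>(n, n + h, m, m + h)\<close> with
  repeated entries.\<close>

definition pair_bound :: "nat \<Rightarrow> nat \<Rightarrow> nat \<Rightarrow> real" where
  "pair_bound h n m = of_bool (h = 0) + of_bool (n = m) + of_bool (n = m + h) + of_bool (m = n + h)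
     + 3 * (k (int h) + k (int n - int m) + k (int n - int h - int m))"

lemma pair_bound_nonneg: "0 \<le> pair_bound h n m"
  unfolding pair_bound_def by (intro add_nonneg_nonneg mult_nonneg_nonneg k_nonneg) auto

text \<open>For four distinct points each pairing contributes a product of two values of
  \<open>k\<close>, and one factor is discarded by \<open>k \<le> 1\<close>. The remaining factor is
  still summable in one of the three indices, which is all that a bound of order
  \<open>N\<^sup>2\<close> for the triple sum requires.\<close>

lemma expectation_pair_le:
  "expectation (\<lambda>\<omega>. (a n \<omega> * a (n + h) \<omega>) * (a m \<omega> * a (m + h) \<omega>)) \<le> pair_bound h n m"
proof (cases "h = 0 \<or> n = m \<or> n = m + h \<or> m = n + h")
  case True
  have "expectation (\<lambda>\<omega>. (a n \<omega> * a (n + h) \<omega>) * (a m \<omega> * a (m + h) \<omega>)) \<le> expectation (\<lambda>_. 1)"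
  proof (intro integral_mono integrable_centered_4)
    fix \<omega>
    have "\<bar>(a n \<omega> * a (n + h) \<omega>) * (a m \<omega> * a (m + h) \<omega>)\<bar> \<le> 1"
      by (simp only: abs_mult) (intro mult_le_one mult_nonneg_nonneg abs_ge_zero abs_centered_le_1)
    then show "(a n \<omega> * a (n + h) \<omega>) * (a m \<omega> * a (m + h) \<omega>) \<le> 1" by linarith
  qed simp
  also have "\<dots> = 1" by (simp add: prob_space)
  also have "1 \<le> of_bool (h = 0) + of_bool (n = m) + of_bool (n = m + h) + (of_bool (m = n + h) :: real)"
    using True by auto
  also have "\<dots> \<le> pair_bound h n m"
    unfolding pair_bound_def using k_nonneg by (simp add: add_nonneg_nonneg)
  finally show ?thesis .
next
  case False
  have k_prod: "k i * k j \<le> k i" for i j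
    using mult_left_mono[OF k_le_1 k_nonneg, of i j] by simp
  have "expectation (\<lambda>\<omega>. (a n \<omega> * a (n + h) \<omega>) * (a m \<omega> * a (m + h) \<omega>))
      = expectation (\<lambda>\<omega>. a n \<omega> * a (n + h) \<omega> * a m \<omega> * a (m + h) \<omega>)"
    by (simp only: mult.assoc)
  also have "\<dots> \<le> 3 * (k (int n - int (n + h)) * k (int m - int (m + h))
      + k (int n - int m) * k (int (n + h) - int (m + h)) + k (int n - int (m + h)) * k (int (n + h) - int m))"
    unfolding k_def using False
    by (intro order_trans[OF abs_ge_self norm_expectation_centered_4_le] hermitian) auto
  also have "\<dots> \<le> 3 * (k (int n - int (n + h)) + k (int n - int m) + k (int n - int (m + h)))"
    by (intro mult_left_mono add_mono k_prod) simp
  also have "\<dots> = pair_bound h n m"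
    using False k_minus[of "int h"] by (simp add: pair_bound_def algebra_simps)
  finally show ?thesis .
qed

text \<open>In the inner sum, three coincidences contribute at most 1 each and two sums of
  \<open>k\<close> at most 3 each with factor 3, which makes 21. The lag 0 adds 1 and the terms
  \<open>k (int h)\<close> add 9, so that 1 + 21 + 9 = 31.\<close>

lemma sum_pair_bound_le: "(\<Sum>h<N. \<Sum>n<N. \<Sum>m<N. pair_bound h n m) \<le> 31 * (real N)\<^sup>2"
proof -
  have unique: "(\<Sum>m<N. of_bool (P m)) \<le> (1 :: real)" if "\<And>m m'. P m \<Longrightarrow> P m' \<Longrightarrow> m = m'" for P
  proof -
    have "card ({..<N} \<inter> {m. P m}) \<le> 1"
      using that by (intro card_le_Suc0_iff_eq[THEN iffD2, unfolded One_nat_def[symmetric]]) auto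
    then show ?thesis by (simp add: sum_of_bool_eq)
  qed
  have inner: "(\<Sum>m<N. pair_bound h n m) \<le> of_bool (h = 0) * real N + 21 + 3 * (real N * k (int h))" for h n
  proof -
    have "(\<Sum>m<N. pair_bound h n m) = of_bool (h = 0) * real N + (\<Sum>m<N. of_bool (n = m))
        + (\<Sum>m<N. of_bool (n = m + h)) + (\<Sum>m<N. of_bool (m = n + h))
        + 3 * (real N * k (int h) + (\<Sum>m<N. k (int n - int m)) + (\<Sum>m<N. k (int n - int h - int m)))"
      unfolding pair_bound_def sum.distrib sum_distrib_left[symmetric] by simp
    moreover have "(\<Sum>m<N. of_bool (n = m)) \<le> (1 :: real)" "(\<Sum>m<N. of_bool (n = m + h)) \<le> (1 :: real)"
        "(\<Sum>m<N. of_bool (m = n + h)) \<le> (1 :: real)"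
      by (rule unique, simp)+
    moreover have "(\<Sum>m<N. k (int n - int m)) \<le> 3" "(\<Sum>m<N. k (int n - int h - int m)) \<le> 3"
      by (rule sum_k_reindex_le, simp add: inj_on_def)+
    moreover have "x \<le> b + 21 + 3 * c"
      if "x = b + s\<^sub>1 + s\<^sub>2 + s\<^sub>3 + 3 * (c + t\<^sub>1 + t\<^sub>2)"
        "s\<^sub>1 \<le> 1" "s\<^sub>2 \<le> 1" "s\<^sub>3 \<le> 1" "t\<^sub>1 \<le> 3" "t\<^sub>2 \<le> 3"
      for x b c s\<^sub>1 s\<^sub>2 s\<^sub>3 t\<^sub>1 t\<^sub>2 :: real
      using that by simp
    ultimately show ?thesis by blast
  qed
  have "(\<Sum>h<N. \<Sum>n<N. \<Sum>m<N. pair_bound h n m) \<le> (\<Sum>h<N. \<Sum>n<N. of_bool (h = 0) * real N + 21 + 3 * (real N * k (int h)))"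
    by (intro sum_mono inner)
  also have "\<dots> = real N * (real N * (\<Sum>h<N. of_bool (h = 0)) + 21 * real N + 3 * real N * (\<Sum>h<N. k (int h)))"
    by (simp add: sum.distrib sum_distrib_left[symmetric] sum_distrib_right[symmetric] algebra_simps)
  also have "\<dots> \<le> real N * (real N * 1 + 21 * real N + 3 * real N * 3)"
    by (intro mult_left_mono add_mono order_refl unique sum_k_reindex_le) (auto simp: inj_on_def)
  also have "\<dots> = 31 * (real N)\<^sup>2" by (simp add: power2_eq_square)
  finally show ?thesis .
qed

text \<open>Squares in place of absolute values: the energy is a polynomial in the centred
  variables, so its expectation is a finite sum of fourth moments.\<close>

definition correlation_energy :: "nat \<Rightarrow> 'w \<Rightarrow> real" where
  "correlation_energy N \<omega> = (\<Sum>h<N. (\<Sum>n<N-h. a n \<omega> * a (n + h) \<omega>)\<^sup>2)"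

lemma correlation_energy_eq:
  "correlation_energy N \<omega> = (\<Sum>h<N. \<Sum>n<N-h. \<Sum>m<N-h. (a n \<omega> * a (n + h) \<omega>) * (a m \<omega> * a (m + h) \<omega>))"
  by (simp only: correlation_energy_def power2_eq_square sum_product)

lemma correlation_energy_nonneg: "0 \<le> correlation_energy N \<omega>"
  unfolding correlation_energy_def by (intro sum_nonneg) simp

lemma integrable_correlation_energy: "integrable P (correlation_energy N)"
  unfolding correlation_energy_eq
  by (intro Bochner_Integration.integrable_sum integrable_centered_4)

lemma expectation_correlation_energy_le: "expectation (correlation_energy N) \<le> 31 * (real N)\<^sup>2"
proof -
  have "expectation (correlation_energy N)
      = (\<Sum>h<N. \<Sum>n<N-h. \<Sum>m<N-h. expectation (\<lambda>\<omega>. (a n \<omega> * a (n + h) \<omega>) * (a m \<omega> * a (m + h) \<omega>)))"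
    unfolding correlation_energy_eq
    by (simp only: Bochner_Integration.integral_sum Bochner_Integration.integrable_sum integrable_centered_4)
  also have "\<dots> \<le> (\<Sum>h<N. \<Sum>n<N-h. \<Sum>m<N-h. pair_bound h n m)"
    by (intro sum_mono expectation_pair_le)
  also have "\<dots> \<le> (\<Sum>h<N. \<Sum>n<N. \<Sum>m<N. pair_bound h n m)"
  proof (rule sum_mono)
    fix h
    have "(\<Sum>n<N-h. \<Sum>m<N-h. pair_bound h n m) \<le> (\<Sum>n<N-h. \<Sum>m<N. pair_bound h n m)"
      by (intro sum_mono sum_mono2) (auto simp: pair_bound_nonneg)
    also have "\<dots> \<le> (\<Sum>n<N. \<Sum>m<N. pair_bound h n m)"
      by (intro sum_mono2 sum_nonneg) (auto simp: pair_bound_nonneg)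
    finally show "(\<Sum>n<N-h. \<Sum>m<N-h. pair_bound h n m) \<le> (\<Sum>n<N. \<Sum>m<N. pair_bound h n m)" .
  qed
  also note sum_pair_bound_le
  finally show ?thesis .
qed

lemma autocorrelation_sum_power2_le:
  "(autocorrelation_sum (\<lambda>n. a n \<omega>) N)\<^sup>2 \<le> N * correlation_energy N \<omega>"
  using sum_squared_le_sum_of_squares[of "\<lambda>h. \<bar>\<Sum>n<N-h. a n \<omega> * a (n + h) \<omega>\<bar>" "{..<N}"]
  by (simp add: autocorrelation_sum_def correlation_energy_def mult.commute)

theorem AE_autocorrelation_sum:
  "AE \<omega> in P. (\<lambda>N. autocorrelation_sum (\<lambda>n. a n \<omega>) N / (real N)\<^sup>2) \<longlonglongrightarrow> 0"
proof -
  let ?Q = "\<lambda>\<omega>. autocorrelation_sum (\<lambda>n. a n \<omega>)"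
  \<comment> \<open>At \<open>N = m\<^sup>2\<close> Cauchy-Schwarz bounds the squared normalised sum
    by \<open>m\<^sup>2\<close> times the energy over \<open>m ^ 8\<close>, which explains the power
    6. The energy has expectation at most \<open>31 * m ^ 4\<close>, leaving the summable
    \<open>31 / m\<^sup>2\<close>.\<close>
  define Z where "Z m \<omega> = correlation_energy (m\<^sup>2) \<omega> / real m ^ 6" for m \<omega>
  have "AE \<omega> in P. (\<lambda>m. Z m \<omega>) \<longlonglongrightarrow> 0"
  proof (rule AE_tendsto_0_if_summable_expectation)
    show "integrable P (Z m)" for m
      unfolding Z_def by (intro integrable_divide integrable_correlation_energy)
    show "0 \<le> Z m \<omega>" for m \<omega>
      by (simp add: Z_def correlation_energy_nonneg)
    show "summable (\<lambda>m. expectation (Z m))"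
    proof (rule summable_comparison_test')
      show "summable (\<lambda>m. 31 * inverse (real m ^ 2))"
        by (intro summable_mult inverse_power_summable) simp
      fix m :: nat assume "m \<ge> 0"
      have "expectation (Z m) = expectation (correlation_energy (m\<^sup>2)) / real m ^ 6"
        unfolding Z_def by simp
      also have "\<dots> \<le> 31 * (real (m\<^sup>2))\<^sup>2 / real m ^ 6"
        by (intro divide_right_mono expectation_correlation_energy_le) simp
      also have "\<dots> = 31 * inverse (real m ^ 2)"
        by (cases "m = 0") (simp_all add: field_simps eval_nat_numeral)
      finally have "expectation (Z m) \<le> 31 * inverse (real m ^ 2)" .
      moreover have "0 \<le> expectation (Z m)"
        by (intro Bochner_Integration.integral_nonneg) (simp add: Z_def correlation_energy_nonneg)
      ultimately show "norm (expectation (Z m)) \<le> 31 * inverse (real m ^ 2)" by simp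
    qed
  qed
  then show ?thesis
  proof eventually_elim
    case (elim \<omega>)
    have "(\<lambda>m. (?Q \<omega> (m\<^sup>2) / real m ^ 4)\<^sup>2) \<longlonglongrightarrow> 0"
    proof (rule tendsto_sandwich[OF _ _ tendsto_const elim])
      have "(?Q \<omega> (m\<^sup>2) / real m ^ 4)\<^sup>2 \<le> Z m \<omega>" for m
      proof -
        have "(?Q \<omega> (m\<^sup>2) / real m ^ 4)\<^sup>2 = (?Q \<omega> (m\<^sup>2))\<^sup>2 / real m ^ 8"
          by (simp add: power_divide)
        also have "\<dots> \<le> real (m\<^sup>2) * correlation_energy (m\<^sup>2) \<omega> / real m ^ 8"
          by (intro divide_right_mono autocorrelation_sum_power2_le) simp
        also have "\<dots> = Z m \<omega>"
          by (cases "m = 0") (simp_all add: Z_def field_simps eval_nat_numeral)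
        finally show ?thesis .
      qed
      then show "\<forall>\<^sub>F m in sequentially. (?Q \<omega> (m\<^sup>2) / real m ^ 4)\<^sup>2 \<le> Z m \<omega>"
        by (intro always_eventually allI)
    qed simp
    then have "(\<lambda>m. sqrt ((?Q \<omega> (m\<^sup>2) / real m ^ 4)\<^sup>2)) \<longlonglongrightarrow> sqrt 0"
      by (rule tendsto_real_sqrt)
    then have "(\<lambda>m. ?Q \<omega> (m\<^sup>2) / real m ^ 4) \<longlonglongrightarrow> 0"
      unfolding real_sqrt_abs real_sqrt_zero by (rule tendsto_rabs_zero_cancel)
    then show ?case
      by (intro LIMSEQ_autocorrelation_sum_of_squares abs_centered_le_1)
  qed
qed

end

section \<open>The theorem\<close>

lemma fourier_coeff_0:
  "fourier_coeff f 0 = complex_of_real (LBINT t:{0..<1}. f t)"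
  unfolding fourier_coeff_def by (simp add: set_integral_complex_of_real)

lemma fourier_coeff_minus: "fourier_coeff f (- n) = cnj (fourier_coeff f n)"
proof -
  have "cnj (fourier_coeff f n) =
    (LINT t|lborel. cnj (indicat_real {0..<1} t *\<^sub>R (complex_of_real (f t) * exp (- 2 * of_real pi * \<i> * of_int n * of_real t))))"
    unfolding fourier_coeff_def set_lebesgue_integral_def by (rule Bochner_Integration.integral_cnj[symmetric])
  also have "\<dots> = fourier_coeff f (- n)"
    unfolding fourier_coeff_def set_lebesgue_integral_def
    by (intro Bochner_Integration.integral_cong) (auto simp: exp_cnj)
  finally show ?thesis by simp
qed

theorem theorem2p1:
  fixes f :: "real \<Rightarrow> real" and P :: "'w measure" and X :: "'w \<Rightarrow> int set"
  assumes "f \<in> borel_measurable borel"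
    and "\<And>t. f (t + 1) = f t"
    and "\<And>t. 0 \<le> f t \<and> f t \<le> 1"
    and "0 < (LBINT t:{0..<1}. f t)" and "(LBINT t:{0..<1}. f t) < 1"
    and "determinantal_process P (\<lambda>n m. fourier_coeff f (n - m)) X"
  shows "(AE \<omega> in P. \<omega> \<in> good_event P X) \<and>
         (\<forall>\<omega>\<in>good_event P X.
            L2_exact TYPE('x) (nonneg_part (X \<omega>)) \<and> recurrent TYPE('x) (nonneg_part (X \<omega>)))"
proof
  let ?s = "LBINT t:{0..<1}. f t"
  have prob: "prob_space P" and sets: "\<And>n. {\<omega> \<in> space P. n \<in> X \<omega>} \<in> sets P"
    and mom: "\<And>k (p :: nat \<Rightarrow> int). inj_on p {..<k} \<Longrightarrow>
        complex_of_real (\<integral>\<omega>. (\<Prod>i<k. indicat_real (X \<omega>) (p i)) \<partial>P) =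
          Determinant.det (mat k k (\<lambda>(i, j). fourier_coeff f (p i - p j)))"
    using assms(6) by (auto simp: determinantal_process_def)
  interpret prob_space P by (rule prob)
  interpret stationary_determinantal_indicators P "fourier_coeff f" "\<lambda>n \<omega>. indicat_real (X \<omega>) n" ?s
  proof
    fix n m :: int and \<omega>
    have "indicat_real {\<omega> \<in> space P. n \<in> X \<omega>} \<in> borel_measurable P" using sets[of n] by simp
    then show "(\<lambda>\<omega>. indicat_real (X \<omega>) n) \<in> borel_measurable P"
      by (rule measurable_cong[THEN iffD1, rotated]) (auto simp: indicator_def)
    show "0 \<le> indicat_real (X \<omega>) n" "indicat_real (X \<omega>) n \<le> 1" by (auto simp: indicator_def)
    show "fourier_coeff f (n - n) = complex_of_real ?s" by (simp add: fourier_coeff_0)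
    show "fourier_coeff f (m - n) = cnj (fourier_coeff f (n - m))"
      using fourier_coeff_minus[of f "n - m"] by simp
    show "complex_of_real (\<integral>\<omega>. (\<Prod>p\<leftarrow>ps. indicat_real (X \<omega>) p) \<partial>P) =
        Determinant.det (mat (length ps) (length ps) (\<lambda>(i, j). fourier_coeff f (ps ! i - ps ! j)))"
      if "distinct ps" for ps
    proof -
      have "(\<Prod>i<length ps. indicat_real (X \<omega>) (ps ! i)) = (\<Prod>p\<leftarrow>ps. indicat_real (X \<omega>) p)" for \<omega>
        by (simp add: prod.list_conv_set_nth lessThan_atLeast0)
      then show ?thesis
        using mom[of "(!) ps" "length ps"] that by (simp add: inj_on_nth)
    qed
  qed
  \<comment> \<open>\<open>good_event\<close> quantifies over all systems on sequences, and its
    measurability is not claimed: the almost-everywhere quantifier asks only that its complement in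
    the space be covered by a null set. The autocorrelation condition provides such a set.\<close>
  show "AE \<omega> in P. \<omega> \<in> good_event P X"
    using AE_autocorrelation_sum AE_space
  proof eventually_elim
    case (elim \<omega>)
    have "indicat_real (X \<omega>) (int n) = indicat_real (nonneg_part (X \<omega>)) n" for n
      by (simp add: nonneg_part_def indicator_def)
    then have "L2_exact TYPE(nat \<Rightarrow> complex) (nonneg_part (X \<omega>))"
      using elim(1) assms(4) by (intro L2_exactI[of ?s]) simp_all
    then show ?case
      using elim(2) by (simp add: good_event_def recurrent_if_L2_exact)
  qed
  \<comment> \<open>Valid for each outcome separately, since the passage from sequences to the type
    \<open>'x\<close> is deterministic; hence one event serves all types.\<close>
  show "\<forall>\<omega>\<in>good_event P X. L2_exact TYPE('x) (nonneg_part (X \<omega>)) \<and> recurrent TYPE('x) (nonneg_part (X \<omega>))"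
    by (auto simp: good_event_def intro: L2_exact_transfer recurrent_if_L2_exact)
qed

end
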